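(* Let $(M,g)$ be a nonempty open Riemannian manifold locally isometric to the complex projective plane $\mathbb{CP}^2$ with its Fubini–Study metric (for instance, a domain in $\mathbb{CP}^2$). Then $(M,g)$ does not admit a limiting Carleman weight.
   Context: Limiting Carleman weight (LCW) on an open Riemannian manifold $(M,g)$: a function $\varphi\in C^\infty(M;\mathbb R)$ with $d\varphi\neq0$ everywhere such that the Poisson bracket $\{\overline{p_\varphi},p_\varphi\}$ vanishes at all points of $T^*M$ where $p_\varphi=0$, with $p_\varphi(x,\xi)=|\xi|_g^2-|d\varphi|_g^2+2i\langle\xi,d\varphi\rangle_g$. Known characterization (Dos Santos Ferreira–Kenig–Salo–Uhlmann): if an open manifold $(M,g)$ has an LCW, then some metric conformal to $g$ admits a parallel unit vector field; the converse holds when $M$ is simply connected. The Fubini–Study metric is the one making the quotient map $S^5\to\mathbb{CP}^2$ of the unit sphere of $\mathbb C^3$ by the diagonal $S^1$-action a Riemannian submersion (sectional curvatures between $1$ and $4$). *)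

theory Defs
  imports "HOL-Analysis.Analysis"
begin

section \<open>Smooth functions on open subsets of Euclidean spaces\<close>

text \<open>Meaningful for open \<open>S\<close> only, which is how it is used throughout.\<close>

primrec Ck_on :: "nat \<Rightarrow> 'e::euclidean_space set \<Rightarrow> ('e \<Rightarrow> 'f::real_normed_vector) \<Rightarrow> bool" where
  "Ck_on 0 S f \<longleftrightarrow> continuous_on S f"
| "Ck_on (Suc k) S f \<longleftrightarrow>
     (\<forall>x\<in>S. f differentiable (at x)) \<and>
     (\<forall>v. Ck_on k S (\<lambda>x. frechet_derivative f (at x) v))"

definition smooth_on :: "'e::euclidean_space set \<Rightarrow> ('e \<Rightarrow> 'f::real_normed_vector) \<Rightarrow> bool" where
  "smooth_on S f \<longleftrightarrow> (\<forall>k. Ck_on k S f)"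


section \<open>Smooth manifolds\<close>

text \<open>A chart is a coordinate domain together with a coordinate map; the values of the map outside
  the domain are irrelevant. A manifold is a topological space \<open>X\<close> with an atlas \<open>A\<close>; manifolds have
  no boundary (this is the sense of ``open''), are assumed neither connected nor non-compact, and
  have dimension \<open>DIM('e)\<close>.\<close>

type_synonym ('a, 'e) chart = "'a set \<times> ('a \<Rightarrow> 'e)"

abbreviation dom_of :: "('a, 'e) chart \<Rightarrow> 'a set" where
  "dom_of c \<equiv> fst c"

abbreviation coord :: "('a, 'e) chart \<Rightarrow> 'a \<Rightarrow> 'e" where
  "coord c \<equiv> snd c"

definition param :: "('a, 'e) chart \<Rightarrow> 'e \<Rightarrow> 'a" where
  "param c = inv_into (dom_of c) (coord c)"

definition is_chart :: "'a topology \<Rightarrow> ('a, 'e::euclidean_space) chart \<Rightarrow> bool" where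
  "is_chart X c \<longleftrightarrow>
     openin X (dom_of c) \<and> open (coord c ` dom_of c) \<and>
     homeomorphic_map (subtopology X (dom_of c)) (top_of_set (coord c ` dom_of c)) (coord c)"

definition second_countable_space :: "'a topology \<Rightarrow> bool" where
  "second_countable_space X \<longleftrightarrow>
     (\<exists>\<B>. countable \<B> \<and> (\<forall>B\<in>\<B>. openin X B) \<and>
        (\<forall>U p. openin X U \<and> p \<in> U \<longrightarrow> (\<exists>B\<in>\<B>. p \<in> B \<and> B \<subseteq> U)))"

definition smooth_manifold ::
  "'a topology \<Rightarrow> ('a, 'e::euclidean_space) chart set \<Rightarrow> bool" where
  "smooth_manifold X A \<longleftrightarrow>
     Hausdorff_space X \<and> second_countable_space X \<and>
     (\<forall>c\<in>A. is_chart X c) \<and> (\<Union>c\<in>A. dom_of c) = topspace X \<and>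
     (\<forall>c\<in>A. \<forall>d\<in>A. smooth_on (coord c ` (dom_of c \<inter> dom_of d)) (coord d \<circ> param c))"

definition smooth_function ::
  "('a, 'e::euclidean_space) chart set \<Rightarrow> ('a \<Rightarrow> real) \<Rightarrow> bool" where
  "smooth_function A \<phi> \<longleftrightarrow> (\<forall>c\<in>A. smooth_on (coord c ` dom_of c) (\<phi> \<circ> param c))"

definition smooth_map_on ::
  "'a topology \<Rightarrow> ('a, 'e::euclidean_space) chart set \<Rightarrow> 'a set \<Rightarrow>
   'b topology \<Rightarrow> ('b, 'f::euclidean_space) chart set \<Rightarrow> ('a \<Rightarrow> 'b) \<Rightarrow> bool" where
  "smooth_map_on X A U Y B f \<longleftrightarrow>
     continuous_map (subtopology X U) Y f \<and>
     (\<forall>c\<in>A. \<forall>d\<in>B. smooth_on (coord c ` {p \<in> U \<inter> dom_of c. f p \<in> dom_of d}) (coord d \<circ> f \<circ> param c))"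


section \<open>Riemannian metrics and local isometries\<close>

text \<open>A metric is given by its components: \<open>g c p\<close> is the inner product of \<open>T\<^sub>p M\<close> written in the
  coordinates of the chart \<open>c\<close>. The last clause is the transformation law of a covariant 2-tensor.\<close>

type_synonym ('a, 'e) metric_components = "('a, 'e) chart \<Rightarrow> 'a \<Rightarrow> 'e \<Rightarrow> 'e \<Rightarrow> real"

definition riemannian_metric ::
  "('a, 'e::euclidean_space) chart set \<Rightarrow> ('a, 'e) metric_components \<Rightarrow> bool" where
  "riemannian_metric A g \<longleftrightarrow>
     (\<forall>c\<in>A. \<forall>p\<in>dom_of c.
        bilinear (g c p) \<and> (\<forall>u v. g c p u v = g c p v u) \<and> (\<forall>u. u \<noteq> 0 \<longrightarrow> 0 < g c p u u)) \<and>
     (\<forall>c\<in>A. \<forall>u v. smooth_on (coord c ` dom_of c) (\<lambda>x. g c (param c x) u v)) \<and>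
     (\<forall>c\<in>A. \<forall>d\<in>A. \<forall>p\<in>dom_of c \<inter> dom_of d. \<forall>u v.
        (let T = frechet_derivative (coord d \<circ> param c) (at (coord c p))
         in g c p u v = g d p (T u) (T v)))"

definition riemannian_manifold ::
  "'a topology \<Rightarrow> ('a, 'e::euclidean_space) chart set \<Rightarrow> ('a, 'e) metric_components \<Rightarrow> bool" where
  "riemannian_manifold X A g \<longleftrightarrow> smooth_manifold X A \<and> riemannian_metric A g"

definition isometry_on ::
  "'a topology \<Rightarrow> ('a, 'e::euclidean_space) chart set \<Rightarrow> ('a, 'e) metric_components \<Rightarrow> 'a set \<Rightarrow>
   'b topology \<Rightarrow> ('b, 'f::euclidean_space) chart set \<Rightarrow> ('b, 'f) metric_components \<Rightarrow> 'b set \<Rightarrow>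
   ('a \<Rightarrow> 'b) \<Rightarrow> bool" where
  "isometry_on X A g U Y B h V f \<longleftrightarrow>
     bij_betw f U V \<and> smooth_map_on X A U Y B f \<and> smooth_map_on Y B V X A (inv_into U f) \<and>
     (\<forall>c\<in>A. \<forall>d\<in>B. \<forall>p\<in>U \<inter> dom_of c. f p \<in> dom_of d \<longrightarrow> (\<forall>u v.
        (let T = frechet_derivative (coord d \<circ> f \<circ> param c) (at (coord c p))
         in g c p u v = h d (f p) (T u) (T v))))"

definition locally_isometric ::
  "'a topology \<Rightarrow> ('a, 'e::euclidean_space) chart set \<Rightarrow> ('a, 'e) metric_components \<Rightarrow>
   'b topology \<Rightarrow> ('b, 'f::euclidean_space) chart set \<Rightarrow> ('b, 'f) metric_components \<Rightarrow> bool" where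
  "locally_isometric X A g Y B h \<longleftrightarrow>
     (\<forall>p\<in>topspace X. \<exists>U V f. openin X U \<and> p \<in> U \<and> openin Y V \<and> isometry_on X A g U Y B h V f)"


section \<open>Limiting Carleman weights\<close>

text \<open>Covectors are written in the canonical coordinates induced by a chart and are identified with
  elements of the model space \<open>'e\<close>: \<open>\<xi>\<close> stands for the linear form \<open>v \<mapsto> \<xi> \<bullet> v\<close>. So no metric of the
  manifold enters this identification. A function on the cotangent bundle becomes a function of
  \<open>(x, \<xi>)\<close>.\<close>

definition differential ::
  "('a, 'e::euclidean_space) chart \<Rightarrow> ('a \<Rightarrow> real) \<Rightarrow> 'e \<Rightarrow> 'e" where
  "differential c \<phi> x = (\<Sum>b\<in>Basis. frechet_derivative (\<phi> \<circ> param c) (at x) b *\<^sub>R b)"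

text \<open>The vector metrically dual to a covector, and the inner product induced on covectors.\<close>

definition sharp :: "('e::euclidean_space \<Rightarrow> 'e \<Rightarrow> real) \<Rightarrow> 'e \<Rightarrow> 'e" where
  "sharp G \<xi> = (THE v. \<forall>w. G v w = \<xi> \<bullet> w)"

definition cometric :: "('e::euclidean_space \<Rightarrow> 'e \<Rightarrow> real) \<Rightarrow> 'e \<Rightarrow> 'e \<Rightarrow> real" where
  "cometric G \<xi> \<eta> = G (sharp G \<xi>) (sharp G \<eta>)"

definition carleman_symbol ::
  "('a, 'e::euclidean_space) metric_components \<Rightarrow> ('a \<Rightarrow> real) \<Rightarrow> ('a, 'e) chart \<Rightarrow>
   'e \<times> 'e \<Rightarrow> complex" where
  "carleman_symbol g \<phi> c = (\<lambda>(x, \<xi>).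
     let G = g c (param c x); d\<phi> = differential c \<phi> x
     in complex_of_real (cometric G \<xi> \<xi> - cometric G d\<phi> d\<phi>)
        + 2 * \<i> * complex_of_real (cometric G \<xi> d\<phi>))"

definition poisson_bracket ::
  "('e::euclidean_space \<times> 'e \<Rightarrow> complex) \<Rightarrow> ('e \<times> 'e \<Rightarrow> complex) \<Rightarrow> 'e \<times> 'e \<Rightarrow> complex" where
  "poisson_bracket a b z = (\<Sum>e\<in>Basis.
     frechet_derivative a (at z) (0, e) * frechet_derivative b (at z) (e, 0)
     - frechet_derivative a (at z) (e, 0) * frechet_derivative b (at z) (0, e))"

definition limiting_carleman_weight ::
  "('a, 'e::euclidean_space) chart set \<Rightarrow> ('a, 'e) metric_components \<Rightarrow> ('a \<Rightarrow> real) \<Rightarrow> bool" where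
  "limiting_carleman_weight A g \<phi> \<longleftrightarrow>
     smooth_function A \<phi> \<and>
     (\<forall>c\<in>A. \<forall>p\<in>dom_of c. differential c \<phi> (coord c p) \<noteq> 0) \<and>
     (\<forall>c\<in>A. \<forall>p\<in>dom_of c. \<forall>\<xi>.
        let P = carleman_symbol g \<phi> c
        in P (coord c p, \<xi>) = 0 \<longrightarrow> poisson_bracket (cnj \<circ> P) P (coord c p, \<xi>) = 0)"


section \<open>The complex projective plane\<close>

text \<open>Points of \<open>CP\<^sup>2\<close> are the orbits of the diagonal circle action on the unit sphere of \<open>\<complex>\<^sup>3\<close>.\<close>

definition hopf :: "complex^3 \<Rightarrow> (complex^3) set" where
  "hopf z = {t *s z | t. norm t = 1}"

abbreviation S5 :: "(complex^3) set" where
  "S5 \<equiv> sphere 0 1"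

definition cp2 :: "(complex^3) set topology" where
  "cp2 = topology (\<lambda>V. V \<subseteq> hopf ` S5 \<and> openin (top_of_set S5) {z \<in> S5. hopf z \<in> V})"

lemma istopology_cp2:
  "istopology (\<lambda>V. V \<subseteq> hopf ` S5 \<and> openin (top_of_set S5) {z \<in> S5. hopf z \<in> V})"
  unfolding istopology_def
proof (intro conjI allI impI)
  fix S T :: "(complex^3) set set"
  assume a: "S \<subseteq> hopf ` S5 \<and> openin (top_of_set S5) {z \<in> S5. hopf z \<in> S}"
    "T \<subseteq> hopf ` S5 \<and> openin (top_of_set S5) {z \<in> S5. hopf z \<in> T}"
  have "{z \<in> S5. hopf z \<in> S \<inter> T} = {z \<in> S5. hopf z \<in> S} \<inter> {z \<in> S5. hopf z \<in> T}"
    by blast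
  then show "openin (top_of_set S5) {z \<in> S5. hopf z \<in> S \<inter> T}"
    using openin_Int[OF conjunct2[OF a(1)] conjunct2[OF a(2)]] by (rule ssubst)
  show "S \<inter> T \<subseteq> hopf ` S5" using a by blast
next
  fix K :: "(complex^3) set set set"
  assume a: "\<forall>V\<in>K. V \<subseteq> hopf ` S5 \<and> openin (top_of_set S5) {z \<in> S5. hopf z \<in> V}"
  have "{z \<in> S5. hopf z \<in> \<Union>K} = \<Union> ((\<lambda>V. {z \<in> S5. hopf z \<in> V}) ` K)" by blast
  moreover have "openin (top_of_set S5) \<dots>" using a by (intro openin_Union) blast
  ultimately show "openin (top_of_set S5) {z \<in> S5. hopf z \<in> \<Union>K}" by simp
  show "\<Union>K \<subseteq> hopf ` S5" using a by blast
qed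

lemma openin_cp2:
  "openin cp2 V \<longleftrightarrow> V \<subseteq> hopf ` S5 \<and> openin (top_of_set S5) {z \<in> S5. hopf z \<in> V}"
  unfolding cp2_def topology_inverse'[OF istopology_cp2] by (rule refl)

lemma topspace_cp2: "topspace cp2 = hopf ` S5"
proof -
  have "{z \<in> S5. hopf z \<in> hopf ` S5} = S5" by blast
  then have "openin cp2 (hopf ` S5)" by (simp add: openin_cp2)
  then show ?thesis
    by (metis openin_cp2 openin_subset openin_topspace subset_antisym)
qed

lemma quotient_map_hopf: "quotient_map (top_of_set S5) cp2 hopf"
  unfolding quotient_map_def topspace_cp2 openin_cp2 topspace_euclidean_subtopology by blast

text \<open>The affine chart \<open>[z] \<mapsto> (z\<^sub>j / z\<^sub>i, z\<^sub>k / z\<^sub>i)\<close>, evaluated on an arbitrary representative.\<close>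

definition affine_chart :: "3 \<Rightarrow> 3 \<Rightarrow> 3 \<Rightarrow> ((complex^3) set, complex^2) chart" where
  "affine_chart i j k =
     (hopf ` {z \<in> S5. z $ i \<noteq> 0},
      \<lambda>p. let z = (SOME z. z \<in> p) in vector [z $ j / z $ i, z $ k / z $ i])"

definition cp2_atlas :: "((complex^3) set, complex^2) chart set" where
  "cp2_atlas = {affine_chart 1 2 3, affine_chart 2 1 3, affine_chart 3 1 2}"


section \<open>The Fubini--Study metric\<close>

text \<open>The differential of the quotient map at a point of the sphere, in a chart of \<open>CP\<^sup>2\<close>. To
  differentiate in the ambient space, the quotient map is extended to be constant on rays; only the
  restriction to \<open>T\<^sub>z S\<^sup>5 = {a. a \<bullet> z = 0}\<close> matters. The inner product of \<open>complex^3\<close> is the real part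
  of the standard Hermitian product.\<close>

definition hopf_diff ::
  "((complex^3) set, complex^2) chart \<Rightarrow> complex^3 \<Rightarrow> complex^3 \<Rightarrow> complex^2" where
  "hopf_diff c z = frechet_derivative (\<lambda>y. coord c (hopf (y /\<^sub>R norm y))) (at z)"

definition vertical :: "((complex^3) set, complex^2) chart \<Rightarrow> complex^3 \<Rightarrow> (complex^3) set" where
  "vertical c z = {a. a \<bullet> z = 0 \<and> hopf_diff c z a = 0}"

definition horizontal :: "((complex^3) set, complex^2) chart \<Rightarrow> complex^3 \<Rightarrow> (complex^3) set" where
  "horizontal c z = {a. a \<bullet> z = 0 \<and> (\<forall>b\<in>vertical c z. a \<bullet> b = 0)}"

definition fubini_study :: "((complex^3) set, complex^2) metric_components" where
  "fubini_study c p u v = (THE r. \<forall>z\<in>p. \<forall>a\<in>horizontal c z. \<forall>b\<in>horizontal c z.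
     hopf_diff c z a = u \<and> hopf_diff c z b = v \<longrightarrow> r = a \<bullet> b)"

lemma coord_affine_chart_hopf:
  "coord (affine_chart i j k) (hopf (y /\<^sub>R norm y)) = vector [y $ j / y $ i, y $ k / y $ i]"
proof -
  define z where "z = (SOME z. z \<in> hopf (y /\<^sub>R norm y))"
  have "y /\<^sub>R norm y \<in> hopf (y /\<^sub>R norm y)"
    unfolding hopf_def by (intro CollectI exI[of _ 1]) simp
  then have "z \<in> hopf (y /\<^sub>R norm y)"
    unfolding z_def by (rule someI)
  then obtain t where t: "norm t = 1" "z = t *s (y /\<^sub>R norm y)"
    unfolding hopf_def by blast
  have "z $ m / z $ i = y $ m / y $ i" for m
  proof (cases "y = 0")
    case False
    have "t \<noteq> 0" using t by auto
    have "z $ m = (t / norm y) * y $ m" for m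
      by (simp only: t(2) vector_smult_component vector_scaleR_component)
        (simp add: scaleR_conv_of_real divide_simps)
    moreover have "t / norm y \<noteq> 0" using \<open>t \<noteq> 0\<close> False by simp
    ultimately show ?thesis by (metis mult_divide_mult_cancel_left)
  qed (simp add: t)
  then show ?thesis
    by (simp add: affine_chart_def Let_def flip: z_def)
qed

lemma has_derivative_hopf:
  assumes "z $ i \<noteq> 0"
  shows "((\<lambda>y. coord (affine_chart i j k) (hopf (y /\<^sub>R norm y))) has_derivative
    (\<lambda>a. vector [(a $ j * z $ i - z $ j * a $ i) / (z $ i * z $ i),
                 (a $ k * z $ i - z $ k * a $ i) / (z $ i * z $ i)])) (at z)"
proof -
  let ?V = "\<lambda>p. vector [fst p, snd p] :: complex^2"
  have "linear ?V"
    by (rule linearI) (simp_all add: vec_eq_iff forall_2)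
  then have V: "bounded_linear ?V" by (simp add: linear_conv_bounded_linear)
  have d: "((\<lambda>y. y $ m / y $ i) has_derivative
      (\<lambda>a. (a $ m * z $ i - z $ m * a $ i) / (z $ i * z $ i))) (at z)" for m
    by (rule has_derivative_divide') (auto intro!: bounded_linear.has_derivative[OF bounded_linear_vec_nth] assms)
  show ?thesis
    unfolding coord_affine_chart_hopf
    using bounded_linear.has_derivative[OF V has_derivative_Pair[OF d[of j] d[of k]]] by simp
qed

lemma hopf_diff_affine_chart:
  assumes "z $ i \<noteq> 0"
  shows "hopf_diff (affine_chart i j k) z a =
    vector [(a $ j * z $ i - z $ j * a $ i) / (z $ i * z $ i),
            (a $ k * z $ i - z $ k * a $ i) / (z $ i * z $ i)]"
  unfolding hopf_diff_def frechet_derivative_at[OF has_derivative_hopf[OF assms], symmetric]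
  by (rule refl)

lemma cp2_atlas_cases:
  assumes "c \<in> cp2_atlas"
  obtains i j k where "c = affine_chart i j k" "\<And>m. m = i \<or> m = j \<or> m = k" "i \<noteq> j" "i \<noteq> k" "j \<noteq> k"
proof -
  have e: "m = 1 \<or> m = 2 \<or> m = 3" for m :: 3 by (rule exhaust_3)
  consider "c = affine_chart 1 2 3" | "c = affine_chart 2 1 3" | "c = affine_chart 3 1 2"
    using assms unfolding cp2_atlas_def by auto
  then show thesis
  proof cases
    case 1 show thesis by (rule that[OF 1]) (use e in auto)
  next
    case 2 show thesis by (rule that[OF 2]) (use e in auto)
  next
    case 3 show thesis by (rule that[OF 3]) (use e in auto)
  qed
qed

lemma hopf_mem: "z \<in> hopf z"
  unfolding hopf_def by (intro CollectI exI[of _ 1]) simp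

lemma dom_affine_chart:
  assumes "hopf z \<in> dom_of (affine_chart i j k)"
  shows "z $ i \<noteq> 0"
proof -
  obtain y where "y $ i \<noteq> 0" "hopf z = hopf y"
    using assms by (auto simp: affine_chart_def)
  with hopf_mem[of y] obtain t where "y = t *s z"
    unfolding hopf_def by auto
  with \<open>y $ i \<noteq> 0\<close> show ?thesis by auto
qed

lemma inner_smult:
  fixes a b :: "complex^'n"
  shows "(t *s a) \<bullet> (t *s b) = (norm t)\<^sup>2 * (a \<bullet> b)"
proof -
  have "(t * x) \<bullet> (t * y) = (norm t)\<^sup>2 * (x \<bullet> y)" for x y
    unfolding inner_complex_def cmod_power2 by (simp add: power2_eq_square algebra_simps)
  then show ?thesis
    by (simp add: inner_vec_def sum_distrib_left)
qed

lemma hopf_diff_rotate: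
  assumes "z $ i \<noteq> 0" "t \<noteq> 0"
  shows "hopf_diff (affine_chart i j k) (t *s z) (t *s a) = hopf_diff (affine_chart i j k) z a"
proof -
  have "(t *s z) $ i \<noteq> 0" using assms by simp
  moreover have "(t * x * (t * y) - t * v * (t * w)) / (t * y * (t * y)) = (x * y - v * w) / (y * y)"
    for x y v w :: complex
  proof -
    have "(t * x * (t * y) - t * v * (t * w)) / (t * y * (t * y)) = ((t * t) * (x * y - v * w)) / ((t * t) * (y * y))"
      by (simp add: algebra_simps)
    then show ?thesis using assms by simp
  qed
  ultimately show ?thesis
    using assms by (simp add: hopf_diff_affine_chart)
qed

lemma hopf_diff_diff:
  assumes "z $ i \<noteq> 0"
  shows "hopf_diff (affine_chart i j k) z (a - b) =
    hopf_diff (affine_chart i j k) z a - hopf_diff (affine_chart i j k) z b"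
  unfolding hopf_diff_affine_chart[OF assms]
  using linear_diff[OF has_derivative_linear[OF has_derivative_hopf[OF assms]]] .

lemma smult_smult_cancel:
  assumes "t \<noteq> (0::complex)"
  shows "t *s (inverse t *s b) = b"
  using assms by (simp add: vector_smult_assoc)

lemma horizontal_rotate:
  assumes z: "z $ i \<noteq> 0" and t: "norm t = 1" and a: "a \<in> horizontal (affine_chart i j k) z"
  shows "t *s a \<in> horizontal (affine_chart i j k) (t *s z)"
proof -
  let ?c = "affine_chart i j k"
  have t0: "t \<noteq> 0" using t by auto
  have "(t *s a) \<bullet> b = 0" if "b \<in> vertical ?c (t *s z)" for b
  proof -
    define b' where "b' = inverse t *s b"
    have b: "b = t *s b'" by (simp add: b'_def smult_smult_cancel t0)
    have "b' \<in> vertical ?c z"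
      using that t hopf_diff_rotate[OF z t0] unfolding b vertical_def by (simp add: inner_smult)
    then show ?thesis using a t unfolding b horizontal_def by (simp add: inner_smult)
  qed
  then show ?thesis using a t unfolding horizontal_def by (simp add: inner_smult)
qed

lemma horizontal_inj:
  assumes z: "z $ i \<noteq> 0" and a: "a \<in> horizontal (affine_chart i j k) z"
    and b: "b \<in> horizontal (affine_chart i j k) z"
    and eq: "hopf_diff (affine_chart i j k) z a = hopf_diff (affine_chart i j k) z b"
  shows "a = b"
proof -
  have "(a - b) \<bullet> z = 0" using a b by (simp add: horizontal_def inner_diff_left)
  then have "a - b \<in> vertical (affine_chart i j k) z"
    using eq by (simp add: vertical_def hopf_diff_diff[OF z])
  then have "(a - b) \<bullet> (a - b) = 0"
    using a b unfolding horizontal_def by (auto simp: inner_diff_left[of a b])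
  then show ?thesis by simp
qed

text \<open>The quotient map is a Riemannian submersion for this metric: its differential maps each
  horizontal space isometrically onto the tangent space of \<open>CP\<^sup>2\<close>.\<close>

lemma fubini_study_hopf:
  assumes "c \<in> cp2_atlas" "hopf z \<in> dom_of c" "a \<in> horizontal c z" "b \<in> horizontal c z"
  shows "fubini_study c (hopf z) (hopf_diff c z a) (hopf_diff c z b) = a \<bullet> b"
proof -
  obtain i j k where c: "c = affine_chart i j k"
    using cp2_atlas_cases[OF assms(1)] by blast
  have z: "z $ i \<noteq> 0" using dom_affine_chart assms(2) unfolding c by blast
  show ?thesis
    unfolding fubini_study_def
  proof (rule the_equality)
    show "\<forall>z'\<in>hopf z. \<forall>a'\<in>horizontal c z'. \<forall>b'\<in>horizontal c z'.
      hopf_diff c z' a' = hopf_diff c z a \<and> hopf_diff c z' b' = hopf_diff c z b \<longrightarrow> a \<bullet> b = a' \<bullet> b'"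
    proof (intro ballI impI, elim conjE)
      fix z' a' b'
      assume h: "z' \<in> hopf z" "a' \<in> horizontal c z'" "b' \<in> horizontal c z'"
        "hopf_diff c z' a' = hopf_diff c z a" "hopf_diff c z' b' = hopf_diff c z b"
      obtain t where t: "norm t = 1" "z' = t *s z" using h(1) unfolding hopf_def by blast
      have t0: "t \<noteq> 0" using t by auto
      have z': "z' $ i \<noteq> 0" using z t0 t by simp
      have "a' = t *s a"
        using h assms(3) horizontal_inj[OF z'] horizontal_rotate[OF z t(1)] hopf_diff_rotate[OF z t0] t(2)
        unfolding c by metis
      moreover have "b' = t *s b"
        using h assms(4) horizontal_inj[OF z'] horizontal_rotate[OF z t(1)] hopf_diff_rotate[OF z t0] t(2)
        unfolding c by metis
      ultimately show "a \<bullet> b = a' \<bullet> b'" using t by (simp add: inner_smult)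
    qed
  qed (use hopf_mem[of z] assms in blast)
qed

lemma hopf_diff_horizontal_onto:
  assumes "c \<in> cp2_atlas" "z \<in> S5" "hopf z \<in> dom_of c"
  shows "hopf_diff c z ` horizontal c z = UNIV"
proof -
  obtain i j k where c: "c = affine_chart i j k" and m: "\<And>m. m = i \<or> m = j \<or> m = k"
    and ne: "i \<noteq> j" "i \<noteq> k" "j \<noteq> k"
    using cp2_atlas_cases[OF assms(1)] by blast
  have zi: "z $ i \<noteq> 0" using dom_affine_chart assms(3) unfolding c by blast
  define H where "H = (\<lambda>a. \<Sum>m\<in>UNIV. a $ m * cnj (z $ m))"
  have Hz: "H z = 1"
  proof -
    have "(norm z)\<^sup>2 = (\<Sum>m\<in>UNIV. (norm (z $ m))\<^sup>2)"
      by (simp add: norm_vec_def L2_set_def sum_nonneg)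
    then have "complex_of_real (\<Sum>m\<in>UNIV. (norm (z $ m))\<^sup>2) = 1" using assms(2) by simp
    then show ?thesis
      unfolding H_def of_real_sum complex_norm_square .
  qed
  have Hi: "a \<bullet> (s *s z) = Re (cnj s * H a)" for a s
    proof -
    have "(a $ m) \<bullet> (s * z $ m) = Re (cnj s * (a $ m * cnj (z $ m)))" for m
      by (simp add: inner_complex_def algebra_simps)
    then show ?thesis
      unfolding H_def inner_vec_def sum_distrib_left Re_sum by simp
  qed
  have "\<exists>a\<in>horizontal c z. hopf_diff c z a = u" for u
  proof -
    define a where "a = (\<chi> m. if m = j then z $ i * u $ 1 else if m = k then z $ i * u $ 2 else 0)"
    define a' where "a' = a - H a *s z"
    have "H a' = H a - H a * H z"
      unfolding a'_def H_def
      by (simp add: sum_subtractf sum_distrib_left left_diff_distrib mult.assoc)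
    then have H0: "H a' = 0" by (simp add: Hz)
    have "a' \<bullet> z = 0" using Hi[of a' 1] H0 by simp
    moreover have "a' \<bullet> b = 0" if b: "b \<in> vertical c z" for b
    proof -
      have "b $ j * z $ i = z $ j * b $ i" "b $ k * z $ i = z $ k * b $ i"
        using b zi unfolding vertical_def c
        by (auto simp: hopf_diff_affine_chart vec_eq_iff forall_2)
      then have "b $ n = (b $ i / z $ i) * z $ n" for n
        using m[of n] zi by (auto simp: nonzero_eq_divide_eq mult.commute)
      then have "b = (b $ i / z $ i) *s z"
        unfolding vec_eq_iff vector_smult_component by blast
      then obtain s where "b = s *s z" by blast
      then show ?thesis using Hi[of a' s] H0 by simp
    qed
    ultimately have "a' \<in> horizontal c z" by (simp add: horizontal_def)
    moreover have "hopf_diff c z a' = u"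
      using zi ne unfolding c a'_def a_def
      by (simp add: hopf_diff_affine_chart vec_eq_iff forall_2 field_simps)
    ultimately show ?thesis by blast
  qed
  then show ?thesis unfolding image_def by (metis (mono_tags, lifting) UNIV_eq_I mem_Collect_eq)
qed

end

(* The obstruction is algebraic: if phi is a limiting Carleman weight with gradient N, then
   polarizing the bracket condition shows that Hess phi is a multiple of the metric on the
   orthogonal complement of N, and the Ricci identity then forces <R(E, JE) N, JN> = 0 for E
   complex-orthogonal to N, whereas for the Fubini-Study metric this is a nonzero multiple of
   |E|^2 |N|^2.

   To avoid connections and curvature tensors, the weight is lifted to a function Psi on an open
   cone of C^3, along the submersion which normalizes a vector, projects it to CP^2 and reads it in
   a chart of M. The horizontal part of the flat Hessian of Psi is the lift of Hess phi, and the
   Ricci identity becomes the symmetry of the third derivatives of Psi: with N the flat gradient of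
   Psi, S its derivative and E the conjugate of the complex cross product of y and N(y), the
   functions <S(iE), iN> and <S(E), iN> vanish identically; differentiating the first along E and
   the second along iE and subtracting leaves -2 |N|^4 = 0. *)
theory Submission
  imports Defs
begin

section \<open>Calculus of continuously differentiable functions\<close>

text \<open>The cone loses nothing: the lift is locally invariant under nonzero complex scalings,
  which is what <N, y> = <N, iy> = 0 says infinitesimally. On vectors Hermitian-orthogonal to y the
  flat metric is |y|^2 times the pull-back of the metric of M, and this factor is harmless because
  its derivative only meets the symbol, which vanishes where the bracket is evaluated. The obstacle
  is that the Carleman condition controls <S(x), x'> only for x, x' orthogonal to N; the mixed
  entries <S(E), N> and <S(iE), N> stay unknown. Testing against iN makes them drop out, and the
  unknown multiple by which S acts on the complement of N cancels in the subtraction. What survives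
  comes from the vertical direction iy, into which the derivatives of E and iE leave the horizontal
  space; there S is known, by differentiating <N, iy> = 0. This is where the curvature of the
  quotient enters. E is given by a formula in y and N, not merely chosen at one point, so that the
  orthogonality relations hold on an open set and can be differentiated.\<close>

lemma Ck_on_cong:
  assumes "open S" "\<And>x. x \<in> S \<Longrightarrow> f x = g x" "Ck_on k S f"
  shows "Ck_on k S g"
  using assms(2,3)
proof (induction k arbitrary: f g)
  case 0
  then show ?case by (simp add: continuous_on_cong[of S S f g])
next
  case (Suc k)
  have d: "(g has_derivative frechet_derivative f (at x)) (at x)" if "x \<in> S" for x
  proof -
    have "(f has_derivative frechet_derivative f (at x)) (at x)"
      using Suc.prems(2) that by (simp add: frechet_derivative_works)
    then show ?thesis
      using Suc.prems(1) by (rule has_derivative_transform_within_open[OF _ \<open>open S\<close> that])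
  qed
  have "Ck_on k S (\<lambda>x. frechet_derivative g (at x) v)" for v
  proof (rule Suc.IH)
    show "Ck_on k S (\<lambda>x. frechet_derivative f (at x) v)" using Suc.prems(2) by simp
  qed (simp add: frechet_derivative_at[OF d])
  then show ?case using d by (auto simp: differentiable_def)
qed

lemma Ck_on_SucI:
  assumes "open S" "\<And>x. x \<in> S \<Longrightarrow> (f has_derivative D x) (at x)" "\<And>v. Ck_on k S (\<lambda>x. D x v)"
  shows "Ck_on (Suc k) S f"
proof -
  have "Ck_on k S (\<lambda>x. frechet_derivative f (at x) v)" for v
    by (rule Ck_on_cong[OF assms(1) _ assms(3)[of v]]) (simp add: frechet_derivative_at[OF assms(2), symmetric])
  then show ?thesis using assms(2) by (auto simp: differentiable_def)
qed

lemma Ck_on_SucD: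
  assumes "Ck_on (Suc k) S f"
  shows "x \<in> S \<Longrightarrow> (f has_derivative frechet_derivative f (at x)) (at x)"
    and "Ck_on k S (\<lambda>x. frechet_derivative f (at x) v)"
  using assms by (auto simp: frechet_derivative_works)

lemma Ck_on_Suc_imp: "Ck_on (Suc k) S f \<Longrightarrow> Ck_on k S f"
proof (induction k arbitrary: f)
  case 0
  then show ?case
    by (auto intro!: continuous_at_imp_continuous_on differentiable_imp_continuous_within)
next
  case (Suc k)
  then show ?case using Ck_on.simps(2) by blast
qed

lemma Ck_on_subset: "Ck_on k S f \<Longrightarrow> T \<subseteq> S \<Longrightarrow> Ck_on k T f"
  by (induction k arbitrary: f) (auto intro: continuous_on_subset)

lemma Ck_on_const: "Ck_on k S (\<lambda>x. c)"
  by (induction k arbitrary: c) auto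

lemma Ck_on_add:
  assumes "open S" "Ck_on k S f" "Ck_on k S g"
  shows "Ck_on k S (\<lambda>x. f x + g x)"
  using assms(2,3)
proof (induction k arbitrary: f g)
  case (Suc k)
  show ?case
    by (rule Ck_on_SucI[OF \<open>open S\<close> has_derivative_add[OF Ck_on_SucD(1)[OF Suc.prems(1)] Ck_on_SucD(1)[OF Suc.prems(2)]]])
      (assumption+, intro Suc.IH Ck_on_SucD(2)[OF Suc.prems(1)] Ck_on_SucD(2)[OF Suc.prems(2)])
qed (auto intro: continuous_intros)

lemma Ck_on_sum:
  assumes "open S" "\<And>i. i \<in> I \<Longrightarrow> Ck_on k S (f i)"
  shows "Ck_on k S (\<lambda>x. \<Sum>i\<in>I. f i x)"
  using assms(2)
  by (induction I rule: infinite_finite_induct) (auto intro: Ck_on_const Ck_on_add[OF assms(1)])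

lemma Ck_on_bounded_linear:
  assumes "open S" "bounded_linear L" "Ck_on k S f"
  shows "Ck_on k S (\<lambda>x. L (f x))"
  using assms(3)
proof (induction k arbitrary: f)
  case 0
  then show ?case using bounded_linear.continuous_on[OF assms(2)] by simp
next
  case (Suc k)
  show ?case
    by (rule Ck_on_SucI[OF \<open>open S\<close> bounded_linear.has_derivative[OF assms(2) Ck_on_SucD(1)[OF Suc.prems]]])
      (assumption+, intro Suc.IH Ck_on_SucD(2)[OF Suc.prems])
qed

text \<open>The product rule leaves one factor undifferentiated in each term, so the induction step
  also needs \<open>f\<close> and \<open>g\<close> themselves at the lower order.\<close>

lemma Ck_on_bounded_bilinear:
  assumes "open S" "bounded_bilinear B" "Ck_on k S f" "Ck_on k S g"
  shows "Ck_on k S (\<lambda>x. B (f x) (g x))"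
  using assms(3,4)
proof (induction k arbitrary: f g)
  case 0
  then show ?case using bounded_bilinear.continuous_on[OF assms(2)] by simp
next
  case (Suc k)
  show ?case
    by (rule Ck_on_SucI[OF \<open>open S\<close> bounded_bilinear.FDERIV[OF assms(2) Ck_on_SucD(1)[OF Suc.prems(1)] Ck_on_SucD(1)[OF Suc.prems(2)]]])
      (assumption+, intro Suc.IH Ck_on_add[OF \<open>open S\<close>] Ck_on_SucD(2)[OF Suc.prems(1)] Ck_on_SucD(2)[OF Suc.prems(2)]
        Ck_on_Suc_imp[OF Suc.prems(1)] Ck_on_Suc_imp[OF Suc.prems(2)])
qed

lemma linear_Basis_expansion:
  fixes L :: "'e::euclidean_space \<Rightarrow> 'f::real_vector"
  assumes "linear L"
  shows "L v = (\<Sum>b\<in>Basis. (v \<bullet> b) *\<^sub>R L b)"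
  by (metis (mono_tags, lifting) assms euclidean_representation linear_scale linear_sum sum.cong)

text \<open>The chain rule evaluates the derivative of \<open>g\<close> in a direction that moves
  with \<open>x\<close>, whereas \<open>Ck_on\<close> speaks of fixed directions. Expanding the
  direction in the basis gives products of fixed-direction derivatives, to which the induction
  hypothesis applies for varying \<open>g\<close>.\<close>

lemma Ck_on_compose:
  fixes f :: "'a::euclidean_space \<Rightarrow> 'b::euclidean_space" and g :: "'b \<Rightarrow> 'c::real_normed_vector"
  assumes "open S" "Ck_on k S f" "Ck_on k T g" "f ` S \<subseteq> T"
  shows "Ck_on k S (\<lambda>x. g (f x))"
  using assms(2,3)
proof (induction k arbitrary: g)
  case 0
  then show ?case using assms(4) by (auto intro: continuous_on_compose2)
next
  case (Suc k)
  have "((\<lambda>x. g (f x)) has_derivative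
      (\<lambda>v. \<Sum>b\<in>Basis. (frechet_derivative f (at x) v \<bullet> b) *\<^sub>R frechet_derivative g (at (f x)) b)) (at x)"
    if "x \<in> S" for x
  proof -
    have g: "(g has_derivative frechet_derivative g (at (f x))) (at (f x))"
      using Ck_on_SucD(1)[OF Suc.prems(2)] that assms(4) by blast
    show ?thesis
      using has_derivative_compose[OF Ck_on_SucD(1)[OF Suc.prems(1) that] g]
      by (subst (asm) linear_Basis_expansion[OF has_derivative_linear[OF g]])
  qed
  then show ?case
  proof (rule Ck_on_SucI[OF \<open>open S\<close>])
    fix v
    show "Ck_on k S (\<lambda>x. \<Sum>b\<in>Basis. (frechet_derivative f (at x) v \<bullet> b) *\<^sub>R frechet_derivative g (at (f x)) b)"
      by (intro Ck_on_sum[OF \<open>open S\<close>] Ck_on_bounded_bilinear[OF \<open>open S\<close> bounded_bilinear_scaleR]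
          Ck_on_bounded_linear[OF \<open>open S\<close> bounded_linear_inner_left] Suc.IH Ck_on_SucD(2)[OF Suc.prems(1)]
          Ck_on_SucD(2)[OF Suc.prems(2)] Ck_on_Suc_imp[OF Suc.prems(1)])
  qed
qed

lemma Ck_on_linear:
  assumes "open S" "bounded_linear L"
  shows "Ck_on k S L"
proof (cases k)
  case 0
  then show ?thesis using assms linear_continuous_on by auto
next
  case (Suc m)
  show ?thesis unfolding Suc
    by (rule Ck_on_SucI[OF assms(1) bounded_linear.has_derivative[OF assms(2) has_derivative_ident]])
      (rule Ck_on_const)
qed

text \<open>The derivative of the inverse is a polynomial in the inverse itself and the derivative
  of \<open>f\<close>, so the induction runs on the order alone.\<close>

lemma Ck_on_inverse:
  fixes f :: "'e::euclidean_space \<Rightarrow> 'f::real_normed_field"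
  assumes "open S" "\<And>x. x \<in> S \<Longrightarrow> f x \<noteq> 0" "Ck_on k S f"
  shows "Ck_on k S (\<lambda>x. inverse (f x))"
  using assms(3)
proof (induction k)
  case 0
  then show ?case using assms(2) by (auto intro: continuous_on_inverse)
next
  case (Suc k)
  show ?case
  proof (rule Ck_on_SucI[OF \<open>open S\<close> Deriv.has_derivative_inverse[OF assms(2) Ck_on_SucD(1)[OF Suc.prems]]])
    fix v
    show "Ck_on k S (\<lambda>x. - (inverse (f x) * frechet_derivative f (at x) v * inverse (f x)))"
      by (intro Ck_on_bounded_linear[OF \<open>open S\<close> bounded_linear_minus[OF bounded_linear_ident]]
          Ck_on_bounded_bilinear[OF \<open>open S\<close> bounded_bilinear_mult] Suc.IH Ck_on_SucD(2)[OF Suc.prems]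
          Ck_on_Suc_imp[OF Suc.prems])
  qed auto
qed

section \<open>Symmetry of second and third derivatives\<close>

text \<open>Two applications of the mean value theorem, along \<open>u\<close> and then along
  \<open>v\<close>. The second difference itself is symmetric in \<open>u\<close> and
  \<open>v\<close>, which is what the Schwarz theorem exploits.\<close>

lemma second_difference_mean_value:
  fixes f :: "'e::euclidean_space \<Rightarrow> real"
  assumes "Ck_on 2 S f" "0 < s" "\<And>a b. \<lbrakk>0 \<le> a; a \<le> s; 0 \<le> b; b \<le> s\<rbrakk> \<Longrightarrow> x + a *\<^sub>R u + b *\<^sub>R v \<in> S"
  obtains a b where "0 \<le> a" "a \<le> s" "0 \<le> b" "b \<le> s"
    "f (x + s *\<^sub>R u + s *\<^sub>R v) - f (x + s *\<^sub>R u) - f (x + s *\<^sub>R v) + f x =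
     s * s * frechet_derivative (\<lambda>y. frechet_derivative f (at y) u) (at (x + a *\<^sub>R u + b *\<^sub>R v)) v"
proof -
  let ?D = "\<lambda>y. frechet_derivative f (at y)"
  have C: "Ck_on (Suc (Suc 0)) S f" using assms(1) by (simp add: numeral_2_eq_2)
  note C1 = Ck_on_SucD[OF C]
  have lin: "linear (frechet_derivative h (at y))" if "(h has_derivative frechet_derivative h (at y)) (at y)"
    for h :: "'e \<Rightarrow> real" and y using that by (rule has_derivative_linear)
  \<comment> \<open>The summand \<open>0 *\<^sub>R v\<close> keeps both terms in the shape treated
    by \<open>d\<close>, with \<open>b = s\<close> and \<open>b = 0\<close>.\<close>
  define g where "g = (\<lambda>a. f (x + a *\<^sub>R u + s *\<^sub>R v) - f (x + a *\<^sub>R u + 0 *\<^sub>R v))"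
  have d: "((\<lambda>a. f (x + a *\<^sub>R u + b *\<^sub>R v)) has_field_derivative ?D (x + a *\<^sub>R u + b *\<^sub>R v) u) (at a)"
    if "0 \<le> a" "a \<le> s" "0 \<le> b" "b \<le> s" for a b
  proof -
    have F: "(f has_derivative ?D (x + a *\<^sub>R u + b *\<^sub>R v)) (at (x + a *\<^sub>R u + b *\<^sub>R v))"
      using C1(1) assms(3) that by blast
    have "((\<lambda>a. x + a *\<^sub>R u + b *\<^sub>R v) has_derivative (\<lambda>h. h *\<^sub>R u)) (at a)"
      by (auto intro!: derivative_eq_intros)
    from has_derivative_imp_has_field_derivative[OF has_derivative_compose[OF this F]] show ?thesis
      by (simp add: linear_scale[OF lin[OF F]])
  qed
  have "\<And>a. 0 \<le> a \<Longrightarrow> a \<le> s \<Longrightarrow> (g has_field_derivative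
      ?D (x + a *\<^sub>R u + s *\<^sub>R v) u - ?D (x + a *\<^sub>R u + 0 *\<^sub>R v) u) (at a)"
    unfolding g_def by (intro DERIV_diff d) (use assms(2) in auto)
  from MVT2[OF assms(2) this] obtain a where a: "0 < a" "a < s"
    "g s - g 0 = (s - 0) * (?D (x + a *\<^sub>R u + s *\<^sub>R v) u - ?D (x + a *\<^sub>R u + 0 *\<^sub>R v) u)" by blast
  let ?E = "\<lambda>b. frechet_derivative (\<lambda>y. ?D y u) (at (x + a *\<^sub>R u + b *\<^sub>R v))"
  have "((\<lambda>b. ?D (x + a *\<^sub>R u + b *\<^sub>R v) u) has_field_derivative ?E b v) (at b)"
    if "0 \<le> b" "b \<le> s" for b
  proof -
    have F: "((\<lambda>y. ?D y u) has_derivative ?E b) (at (x + a *\<^sub>R u + b *\<^sub>R v))"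
      by (rule Ck_on_SucD(1)[OF C1(2)]) (use assms(3) that a in auto)
    have "((\<lambda>b. x + a *\<^sub>R u + b *\<^sub>R v) has_derivative (\<lambda>h. h *\<^sub>R v)) (at b)"
      by (auto intro!: derivative_eq_intros)
    from has_derivative_imp_has_field_derivative[OF has_derivative_compose[OF this F]] show ?thesis
      by (simp add: linear_scale[OF lin[OF F]])
  qed
  from MVT2[OF assms(2) this] obtain b where b: "0 < b" "b < s"
    "?D (x + a *\<^sub>R u + s *\<^sub>R v) u - ?D (x + a *\<^sub>R u + 0 *\<^sub>R v) u = (s - 0) * ?E b v" by blast
  show thesis
    by (rule that[of a b]) (use a b in \<open>auto simp: g_def\<close>)
qed

text \<open>Both mixed derivatives, at suitable points of a small parallelogram, equal the same
  second difference divided by \<open>s * s\<close>; continuity moves them to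
  \<open>x\<close>.\<close>

lemma symmetric_second_derivative:
  fixes f :: "'e::euclidean_space \<Rightarrow> real"
  assumes "Ck_on 2 S f" "open S" "x \<in> S"
  shows "frechet_derivative (\<lambda>y. frechet_derivative f (at y) u) (at x) v =
    frechet_derivative (\<lambda>y. frechet_derivative f (at y) v) (at x) u"
proof -
  let ?H = "\<lambda>u v y. frechet_derivative (\<lambda>y. frechet_derivative f (at y) u) (at y) v"
  have c: "isCont (?H u v) x" for u v
    using assms by (simp add: numeral_2_eq_2 continuous_on_eq_continuous_at)
  have "\<bar>?H u v x - ?H v u x\<bar> \<le> e" if "0 < e" for e
  proof -
    obtain d1 where d1: "0 < d1" "\<And>y. dist y x < d1 \<Longrightarrow> dist (?H u v y) (?H u v x) < e / 2"
      using c[of u v] \<open>0 < e\<close> unfolding continuous_at_eps_delta dist_norm by (metis half_gt_zero)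
    obtain d2 where d2: "0 < d2" "\<And>y. dist y x < d2 \<Longrightarrow> dist (?H v u y) (?H v u x) < e / 2"
      using c[of v u] \<open>0 < e\<close> unfolding continuous_at_eps_delta dist_norm by (metis half_gt_zero)
    obtain d3 where d3: "0 < d3" "\<And>y. dist y x < d3 \<Longrightarrow> y \<in> S"
      using assms(2,3) by (auto simp: open_dist)
    define d where "d = min d1 (min d2 d3)"
    \<comment> \<open>With \<open>s = d / (2 * K)\<close> the whole parallelogram stays within
      \<open>d / 2\<close> of \<open>x\<close>; the summand 1 keeps \<open>K\<close> positive when
      \<open>u = v = 0\<close>.\<close>
    define K where "K = norm u + norm v + 1"
    define s where "s = d / (2 * K)"
    have pos: "K > 0" by (simp add: K_def add_nonneg_pos)
    have "0 < d" using d1 d2 d3 by (simp add: d_def)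
    then have s: "0 < s" using pos by (simp add: s_def)
    have near: "dist (x + a *\<^sub>R u + b *\<^sub>R v) x < d" if "0 \<le> a" "a \<le> s" "0 \<le> b" "b \<le> s" for a b
    proof -
      have "dist (x + a *\<^sub>R u + b *\<^sub>R v) x \<le> a * norm u + b * norm v"
        using norm_triangle_ineq[of "a *\<^sub>R u" "b *\<^sub>R v"] that by (simp add: dist_norm add.assoc)
      also have "\<dots> \<le> s * norm u + s * norm v"
        using that by (intro add_mono mult_right_mono) auto
      also have "\<dots> \<le> s * K" using s by (simp add: K_def algebra_simps)
      also have "\<dots> = d / 2" using pos unfolding s_def K_def[symmetric] by simp
      also have "\<dots> < d" using \<open>0 < d\<close> by simp
      finally show ?thesis .
    qed
    obtain a b where ab: "0 \<le> a" "a \<le> s" "0 \<le> b" "b \<le> s"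
      "f (x + s *\<^sub>R u + s *\<^sub>R v) - f (x + s *\<^sub>R u) - f (x + s *\<^sub>R v) + f x =
        s * s * ?H u v (x + a *\<^sub>R u + b *\<^sub>R v)"
      by (rule second_difference_mean_value[OF assms(1) s, of x u v]) (use near d3 in \<open>auto simp: d_def\<close>)
    obtain a' b' where ab': "0 \<le> a'" "a' \<le> s" "0 \<le> b'" "b' \<le> s"
      "f (x + s *\<^sub>R v + s *\<^sub>R u) - f (x + s *\<^sub>R v) - f (x + s *\<^sub>R u) + f x =
        s * s * ?H v u (x + a' *\<^sub>R v + b' *\<^sub>R u)"
    proof (rule second_difference_mean_value[OF assms(1) s, of x v u])
      fix a b :: real assume "0 \<le> a" "a \<le> s" "0 \<le> b" "b \<le> s"
      then show "x + a *\<^sub>R v + b *\<^sub>R u \<in> S"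
        using near[of b a] d3 by (auto simp: d_def add.assoc add.commute[of "_ *\<^sub>R v"])
    qed
    have eq: "x + s *\<^sub>R v + s *\<^sub>R u = x + s *\<^sub>R u + s *\<^sub>R v"
      "x + a' *\<^sub>R v + b' *\<^sub>R u = x + b' *\<^sub>R u + a' *\<^sub>R v" by simp_all
    have "s * s * ?H u v (x + a *\<^sub>R u + b *\<^sub>R v) = s * s * ?H v u (x + b' *\<^sub>R u + a' *\<^sub>R v)"
      using ab(5) ab'(5) unfolding eq by linarith
    then have e: "?H u v (x + a *\<^sub>R u + b *\<^sub>R v) = ?H v u (x + b' *\<^sub>R u + a' *\<^sub>R v)" using s by simp
    have "dist (?H u v (x + a *\<^sub>R u + b *\<^sub>R v)) (?H u v x) < e / 2"
      by (rule d1) (use near[of a b] ab in \<open>auto simp: d_def\<close>)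
    moreover have "dist (?H v u (x + b' *\<^sub>R u + a' *\<^sub>R v)) (?H v u x) < e / 2"
      by (rule d2) (use near[of b' a'] ab' in \<open>auto simp: d_def\<close>)
    ultimately show ?thesis unfolding e dist_real_def by linarith
  qed
  then have "\<bar>?H u v x - ?H v u x\<bar> \<le> 0" by (rule field_le_epsilon[of _ 0, simplified])
  then show ?thesis by simp
qed

text \<open>Pairing with a constant vector reduces this to real functions. Applied to a gradient it
  gives the symmetry of third derivatives that replaces the Ricci identity.\<close>

lemma symmetric_second_derivative_vector:
  fixes f :: "'e::euclidean_space \<Rightarrow> 'f::real_inner"
  assumes "Ck_on 2 S f" "open S" "x \<in> S"
  shows "frechet_derivative (\<lambda>y. frechet_derivative f (at y) u) (at x) v =
    frechet_derivative (\<lambda>y. frechet_derivative f (at y) v) (at x) u"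
proof -
  have C: "Ck_on (Suc (Suc 0)) S f" using assms(1) by (simp add: numeral_2_eq_2)
  note C1 = Ck_on_SucD[OF C]
  have d: "frechet_derivative (\<lambda>y. f y \<bullet> c) (at y) w = frechet_derivative f (at y) w \<bullet> c" if "y \<in> S" for y w c
    using frechet_derivative_at[OF has_derivative_inner_left[OF C1(1)[OF that]], of c] by metis
  have dd: "frechet_derivative (\<lambda>y. frechet_derivative (\<lambda>y. f y \<bullet> c) (at y) u) (at x) v =
      frechet_derivative (\<lambda>y. frechet_derivative f (at y) u) (at x) v \<bullet> c" for u v c
  proof -
    have "((\<lambda>y. frechet_derivative f (at y) u \<bullet> c) has_derivative
        (\<lambda>v. frechet_derivative (\<lambda>y. frechet_derivative f (at y) u) (at x) v \<bullet> c)) (at x)"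
      by (intro has_derivative_inner_left Ck_on_SucD(1)[OF C1(2)] assms)
    then have "((\<lambda>y. frechet_derivative (\<lambda>y. f y \<bullet> c) (at y) u) has_derivative
        (\<lambda>v. frechet_derivative (\<lambda>y. frechet_derivative f (at y) u) (at x) v \<bullet> c)) (at x)"
      by (rule has_derivative_transform_within_open[OF _ assms(2,3)]) (simp add: d)
    from frechet_derivative_at[OF this] show ?thesis by metis
  qed
  let ?d = "frechet_derivative (\<lambda>y. frechet_derivative f (at y) u) (at x) v -
    frechet_derivative (\<lambda>y. frechet_derivative f (at y) v) (at x) u"
  have "?d \<bullet> c = 0" for c
    using symmetric_second_derivative[OF Ck_on_bounded_linear[OF assms(2) bounded_linear_inner_left assms(1)] assms(2,3)]
    unfolding inner_diff_left dd[symmetric] by simp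
  from this[of ?d] show ?thesis by simp
qed

section \<open>Gradients and Hessians\<close>

definition grad :: "('n::euclidean_space \<Rightarrow> real) \<Rightarrow> 'n \<Rightarrow> 'n" where
  "grad f y = (\<Sum>b\<in>Basis. frechet_derivative f (at y) b *\<^sub>R b)"

abbreviation hess :: "('n::euclidean_space \<Rightarrow> real) \<Rightarrow> 'n \<Rightarrow> 'n \<Rightarrow> 'n" where
  "hess f y \<equiv> frechet_derivative (grad f) (at y)"

lemma grad_inner:
  assumes "(f has_derivative D) (at y)"
  shows "grad f y \<bullet> v = D v"
proof -
  have "D v = (\<Sum>b\<in>Basis. (v \<bullet> b) *\<^sub>R D b)"
    by (rule linear_Basis_expansion[OF has_derivative_linear[OF assms]])
  then show ?thesis
    by (simp add: grad_def inner_sum_left inner_sum_right frechet_derivative_at[OF assms, symmetric] inner_commute mult.commute)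
qed

lemma grad_unique:
  assumes "(f has_derivative (\<lambda>v. a \<bullet> v)) (at y)"
  shows "grad f y = a"
  using grad_inner[OF assms] by (metis vector_eq_rdot)

text \<open>By the chain rule only the value of \<open>grad f\<close> at \<open>F y\<close> matters,
  so it may be frozen. The gradient of a pulled-back function thus has the same form as the
  gradients of \<open>\<xi> \<bullet> F\<close>, with the differential of \<open>f\<close> as
  covector.\<close>

lemma grad_compose:
  assumes F: "(F has_derivative F') (at y)" and f: "(f has_derivative f') (at (F y))"
  shows "grad (\<lambda>z. f (F z)) y = grad (\<lambda>z. grad f (F y) \<bullet> F z) y"
proof (rule grad_unique)
  have "f' (F' v) = grad (\<lambda>z. grad f (F y) \<bullet> F z) y \<bullet> v" for v
    by (rule trans[OF grad_inner[OF f, symmetric] grad_inner[OF has_derivative_inner_right[OF F], symmetric]])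
  then show "((\<lambda>z. f (F z)) has_derivative (\<lambda>v. grad (\<lambda>z. grad f (F y) \<bullet> F z) y \<bullet> v)) (at y)"
    using has_derivative_compose[OF F f] by simp
qed

lemma Ck_on_grad:
  assumes "open S" "Ck_on (Suc k) S f"
  shows "Ck_on k S (grad f)"
  unfolding grad_def[abs_def]
  by (intro Ck_on_sum[OF assms(1)] Ck_on_bounded_linear[OF assms(1) bounded_linear_scaleR_left]
      Ck_on_SucD(2)[OF assms(2)])

lemma has_derivative_grad:
  assumes "open S" "Ck_on 2 S f" "y \<in> S"
  shows "(grad f has_derivative hess f y) (at y)"
  by (rule Ck_on_SucD(1)[OF Ck_on_grad[OF assms(1), of "Suc 0"] assms(3)]) (use assms(2) in \<open>simp add: numeral_2_eq_2\<close>)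

lemma hess_symmetric:
  fixes f :: "'n::euclidean_space \<Rightarrow> real"
  assumes "open S" "Ck_on 2 S f" "y \<in> S"
  shows "hess f y u \<bullet> v = u \<bullet> hess f y v"
proof -
  have C: "Ck_on (Suc (Suc 0)) S f" using assms(2) by (simp add: numeral_2_eq_2)
  have "frechet_derivative (\<lambda>y. frechet_derivative f (at y) v) (at y) u = hess f y u \<bullet> v" for u v
  proof -
    have "((\<lambda>y. grad f y \<bullet> v) has_derivative (\<lambda>u. hess f y u \<bullet> v)) (at y)"
      by (intro has_derivative_inner_left has_derivative_grad[OF assms])
    then have "((\<lambda>y. frechet_derivative f (at y) v) has_derivative (\<lambda>u. hess f y u \<bullet> v)) (at y)"
      by (rule has_derivative_transform_within_open[OF _ assms(1,3)])
        (rule grad_inner[OF Ck_on_SucD(1)[OF C]])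
    from frechet_derivative_at[OF this] show ?thesis by metis
  qed
  then show ?thesis
    using symmetric_second_derivative[OF assms(2,1,3)] by (metis inner_commute)
qed

section \<open>Rigidity in flat space\<close>

definition herm :: "complex^3 \<Rightarrow> complex^3 \<Rightarrow> complex" where
  "herm a b = (\<Sum>k\<in>UNIV. a $ k * cnj (b $ k))"

abbreviation J :: "complex^3 \<Rightarrow> complex^3" where
  "J a \<equiv> \<i> *s a"

text \<open>The conjugate of the complex cross product. Conjugation turns its complex-bilinear
  orthogonality to both factors into Hermitian orthogonality, and makes it antilinear over the
  complex numbers in each argument while still real bilinear.\<close>

definition hcross :: "complex^3 \<Rightarrow> complex^3 \<Rightarrow> complex^3" where
  "hcross a b = vector [cnj (a $ 2 * b $ 3 - a $ 3 * b $ 2),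
                        cnj (a $ 3 * b $ 1 - a $ 1 * b $ 3),
                        cnj (a $ 1 * b $ 2 - a $ 2 * b $ 1)]"

lemma hcross_nth:
  "hcross a b $ 1 = cnj (a $ 2 * b $ 3 - a $ 3 * b $ 2)"
  "hcross a b $ 2 = cnj (a $ 3 * b $ 1 - a $ 1 * b $ 3)"
  "hcross a b $ 3 = cnj (a $ 1 * b $ 2 - a $ 2 * b $ 1)"
  by (simp_all add: hcross_def)

lemma inner_eq_Re_herm: "a \<bullet> b = Re (herm a b)"
  by (simp add: herm_def inner_vec_def inner_complex_def)

lemma inner_J_eq_Im_herm: "a \<bullet> J b = Im (herm a b)"
  by (simp add: herm_def inner_vec_def inner_complex_def algebra_simps)

lemma herm_eq_0_iff: "herm a b = 0 \<longleftrightarrow> a \<bullet> b = 0 \<and> a \<bullet> J b = 0"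
  unfolding inner_J_eq_Im_herm unfolding inner_eq_Re_herm by (simp add: complex_eq_iff)

lemma cnj_herm: "cnj (herm a b) = herm b a"
  by (simp add: herm_def mult.commute)

lemma herm_eq_0_commute: "herm a b = 0 \<longleftrightarrow> herm b a = 0"
  by (metis cnj_herm complex_cnj_zero)

lemma herm_self: "herm a a = of_real (a \<bullet> a)"
  by (simp add: complex_eq_iff inner_eq_Re_herm herm_def)

lemma inner_J_left: "J a \<bullet> b = - (a \<bullet> J b)"
  by (simp add: inner_vec_def inner_complex_def flip: sum_negf)

lemma inner_J_J [simp]: "J a \<bullet> J b = a \<bullet> b"
  by (simp add: inner_smult)

lemma inner_J_self [simp]: "a \<bullet> J a = 0" "J a \<bullet> a = 0"
  using inner_J_left[of a a] inner_commute[of a "J a"] by simp_all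

lemma bounded_linear_J: "bounded_linear J"
  unfolding linear_conv_bounded_linear[symmetric]
  by (rule linearI) (simp_all add: vec_eq_iff algebra_simps scaleR_conv_of_real[where 'a=complex])

lemma bounded_bilinear_hcross: "bounded_bilinear hcross"
  unfolding bilinear_conv_bounded_bilinear[symmetric] bilinear_def
  by (auto intro!: linearI simp: vec_eq_iff forall_3 hcross_nth algebra_simps scaleR_conv_of_real[where 'a=complex])

lemma hcross_J: "hcross (J a) b = - J (hcross a b)" "hcross a (J b) = - J (hcross a b)"
  by (simp_all add: vec_eq_iff forall_3 hcross_nth algebra_simps)

lemma hcross_hcross:
  "hcross (hcross a b) c = herm a c *s b - herm b c *s a"
  by (simp add: vec_eq_iff forall_3 hcross_nth herm_def sum_3 algebra_simps)

lemma hcross_hcross_right: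
  "hcross a (hcross b c) = herm c a *s b - herm b a *s c"
  by (simp add: vec_eq_iff forall_3 hcross_nth herm_def sum_3 algebra_simps)

lemma herm_hcross: "herm (hcross a b) a = 0" "herm (hcross a b) b = 0"
  by (simp_all add: herm_def sum_3 hcross_nth algebra_simps)

lemma herm_hcross_self:
  "herm (hcross a b) (hcross a b) = herm a a * herm b b - herm a b * herm b a"
  by (simp add: herm_def sum_3 hcross_nth algebra_simps)

lemma of_real_smult_eq_scaleR: "of_real r *s (a :: complex^'n) = r *\<^sub>R a"
  by (simp add: vec_eq_iff scaleR_conv_of_real[where 'a=complex])

lemma inner_hcross_self:
  assumes "herm a b = 0"
  shows "hcross a b \<bullet> hcross a b = (a \<bullet> a) * (b \<bullet> b)"
  using herm_hcross_self[of a b] assms cnj_herm[of a b]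
  by (simp add: herm_self del: of_real_mult flip: of_real_mult)

text \<open>No dimension count is made: orthogonality to \<open>a\<close> and \<open>b\<close> kills
  \<open>hcross (hcross a b) x\<close> by the triple product formula, while orthogonality to
  \<open>hcross a b\<close> makes its squared norm the product of those of \<open>hcross a b\<close>
  and \<open>x\<close>.\<close>

lemma unitary_frame_orthogonal_imp_0:
  assumes "herm a b = 0" "a \<noteq> 0" "b \<noteq> 0"
    "herm x a = 0" "herm x b = 0" "herm x (hcross a b) = 0"
  shows "x = 0"
proof -
  have "herm a x = 0" "herm b x = 0" "herm (hcross a b) x = 0"
    using assms herm_eq_0_commute by blast+
  then have "hcross (hcross a b) x = 0" by (simp add: hcross_hcross)
  then have "(hcross a b \<bullet> hcross a b) * (x \<bullet> x) = 0"
    using inner_hcross_self[OF \<open>herm (hcross a b) x = 0\<close>] by simp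
  then show ?thesis using assms(1-3) by (simp add: inner_hcross_self)
qed

section \<open>The rigidity argument\<close>

text \<open>The derivative of \<open>S\<close> is given on fixed vectors only, so the moving
  argument \<open>X y\<close> is expanded in the basis before the product rule is applied.\<close>

lemma has_derivative_apply:
  fixes S :: "'e::euclidean_space \<Rightarrow> 'f::euclidean_space \<Rightarrow> 'g::real_normed_vector"
  assumes "open W" "w \<in> W" "\<And>y. y \<in> W \<Longrightarrow> linear (S y)"
    "\<And>v. ((\<lambda>y. S y v) has_derivative T v) (at w)" "(X has_derivative X') (at w)"
  shows "((\<lambda>y. S y (X y)) has_derivative (\<lambda>v. S w (X' v) + (\<Sum>b\<in>Basis. (X w \<bullet> b) *\<^sub>R T b v))) (at w)"
proof -
  have "((\<lambda>y. \<Sum>b\<in>Basis. (X y \<bullet> b) *\<^sub>R S y b) has_derivative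
      (\<lambda>v. \<Sum>b\<in>Basis. (X w \<bullet> b) *\<^sub>R T b v + (X' v \<bullet> b) *\<^sub>R S w b)) (at w)"
    by (intro has_derivative_sum has_derivative_scaleR assms(4) has_derivative_inner_left assms(5))
  then have "((\<lambda>y. S y (X y)) has_derivative
      (\<lambda>v. \<Sum>b\<in>Basis. (X w \<bullet> b) *\<^sub>R T b v + (X' v \<bullet> b) *\<^sub>R S w b)) (at w)"
    by (rule has_derivative_transform_within_open[OF _ assms(1,2)])
      (simp flip: linear_Basis_expansion[OF assms(3)])
  moreover have "(\<Sum>b\<in>Basis. (X' v \<bullet> b) *\<^sub>R S w b) = S w (X' v)" for v
    by (rule linear_Basis_expansion[OF assms(3)[OF assms(2)], symmetric])
  ultimately show ?thesis by (simp add: sum.distrib add.commute)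
qed

lemma has_derivative_locally_zero:
  assumes "(f has_derivative D) (at w)" "open W" "w \<in> W" "\<And>y. y \<in> W \<Longrightarrow> f y = 0"
  shows "D v = 0"
proof -
  have "(f has_derivative (\<lambda>v. 0)) (at w)"
    by (rule has_derivative_transform_within_open[OF has_derivative_const[of 0] assms(2,3)]) (simp add: assms(4))
  with assms(1) show ?thesis by (rule fun_cong[OF has_derivative_unique])
qed

text \<open>The hypotheses are those met by the gradient \<open>N\<close> of a function invariant
  under nonzero complex scalings, with \<open>S\<close> and \<open>T\<close> its second and third
  derivatives. In \<open>carleman\<close>, the vector \<open>x\<close> is the lift of a covector at
  which the symbol vanishes.\<close>

lemma flat_rigidity:
  fixes N :: "complex^3 \<Rightarrow> complex^3" and S T :: "complex^3 \<Rightarrow> complex^3 \<Rightarrow> complex^3"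
  assumes W: "open W" "w \<in> W" "w \<noteq> 0"
    and dN: "\<And>y. y \<in> W \<Longrightarrow> (N has_derivative S y) (at y)"
    and dS: "\<And>v. ((\<lambda>y. S y v) has_derivative T v) (at w)"
    and symT: "\<And>u v. T u v = T v u"
    and symS: "\<And>y u v. y \<in> W \<Longrightarrow> S y u \<bullet> v = u \<bullet> S y v"
    and Ny: "\<And>y. y \<in> W \<Longrightarrow> N y \<bullet> y = 0" and NJy: "\<And>y. y \<in> W \<Longrightarrow> N y \<bullet> J y = 0"
    and carleman: "\<And>y x. \<lbrakk>y \<in> W; x \<bullet> y = 0; x \<bullet> J y = 0; x \<bullet> N y = 0; norm x = norm (N y)\<rbrakk> \<Longrightarrow>
      S y x \<bullet> x + S y (N y) \<bullet> N y = 0"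
  shows "N w = 0"
proof (rule ccontr)
  assume nz: "N w \<noteq> 0"
  interpret J: bounded_linear J by (rule bounded_linear_J)
  interpret hc: bounded_bilinear hcross by (rule bounded_bilinear_hcross)
  have linS: "linear (S y)" if "y \<in> W" for y using dN[OF that] by (rule has_derivative_linear)
  define E where "E y = hcross y (N y)" for y
  define K where "K y = {x. x \<bullet> y = 0 \<and> x \<bullet> J y = 0 \<and> x \<bullet> N y = 0}" for y
  \<comment> \<open>Both sides are quadratic in \<open>x\<close>, so rescaling \<open>x\<close> to
    the norm of \<open>N y\<close> removes the norm condition in \<open>carleman\<close>.\<close>
  have quad: "(N y \<bullet> N y) * (S y x \<bullet> x) = - (x \<bullet> x) * (S y (N y) \<bullet> N y)" if "y \<in> W" "x \<in> K y" for x y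
  proof (cases "x = 0")
    case False
    define c where "c = norm (N y) / norm x"
    have "S y (c *\<^sub>R x) \<bullet> (c *\<^sub>R x) + S y (N y) \<bullet> N y = 0"
      by (rule carleman) (use that False in \<open>auto simp: K_def c_def\<close>)
    then have "(c * c) * (S y x \<bullet> x) = - (S y (N y) \<bullet> N y)"
      by (simp add: linear_scale[OF linS[OF that(1)]])
    moreover have "c * c = (N y \<bullet> N y) / (x \<bullet> x)"
      by (simp add: c_def dot_square_norm power2_eq_square)
    ultimately show ?thesis using False by (simp add: field_simps)
  qed (simp add: linear_0[OF linS[OF that(1)]])
  \<comment> \<open>Polarization, using that \<open>S y\<close> is symmetric: as a bilinear form
    \<open>S y\<close> is a multiple of the inner product on \<open>K y\<close>.\<close>
  have polar: "(N y \<bullet> N y) * (S y u \<bullet> v) = - (u \<bullet> v) * (S y (N y) \<bullet> N y)"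
    if "y \<in> W" "u \<in> K y" "v \<in> K y" for y u v
  proof -
    have "u + v \<in> K y" using that by (simp add: K_def inner_add_left)
    from quad[OF that(1) this] quad[OF that(1,2)] quad[OF that(1,3)] show ?thesis
      using symS[OF that(1), of v u]
      by (simp add: linear_add[OF linS[OF that(1)]] inner_add_left inner_add_right algebra_simps inner_commute)
  qed
  \<comment> \<open>\<open>K y\<close> is only real-orthogonal to \<open>N y\<close>, which leaves
    room for this vector.\<close>
  have NJN: "J (N y) \<in> K y" if "y \<in> W" for y
    using Ny[OF that] NJy[OF that] by (simp add: K_def inner_J_left)
  have hermN: "herm (N y) y = 0" "herm y (N y) = 0" if "y \<in> W" for y
    using Ny[OF that] NJy[OF that] herm_eq_0_commute herm_eq_0_iff by blast+
  have Ey: "E y \<bullet> y = 0" "E y \<bullet> J y = 0" "E y \<bullet> N y = 0" "E y \<bullet> J (N y) = 0" for y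
    using herm_hcross[of y "N y"] by (auto simp: herm_eq_0_iff E_def)
  then have EK: "E y \<in> K y" "J (E y) \<in> K y" for y
    by (auto simp: K_def inner_J_left)
  \<comment> \<open>\<open>E y\<close> is complex-orthogonal to \<open>N y\<close>, so these are
    off-diagonal entries of a form proportional to the inner product. They vanish at every
    \<open>y\<close> of \<open>W\<close> and may be differentiated.\<close>
  have zero: "S y (J (E y)) \<bullet> J (N y) = 0" "S y (E y) \<bullet> J (N y) = 0" if "y \<in> W" for y
    using polar[OF that EK(2) NJN[OF that]] polar[OF that EK(1) NJN[OF that]] Ey[of y]
    by auto
  let ?n = "N w" and ?S = "S w" and ?e = "E w"
  define E' where "E' v = hcross v ?n + hcross w (?S v)" for v
  have dE: "(E has_derivative E') (at w)"
    unfolding E_def[abs_def] E'_def[abs_def]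
    using hc.FDERIV[OF has_derivative_ident dN[OF W(2)]] by (simp add: add.commute)
  \<comment> \<open>The basis sum produced by \<open>has_derivative_apply\<close> is a third
    derivative with its two arguments swapped; \<open>symT\<close> restores their order.\<close>
  have sumT: "(\<Sum>b\<in>Basis. (x \<bullet> b) *\<^sub>R T b v) = T v x" for x v
    using linear_Basis_expansion[OF has_derivative_linear[OF dS[of v]], of x] by (simp add: symT[of _ v])
  have D: "(?S (X' v) + T v (X w)) \<bullet> J ?n + ?S (X w) \<bullet> J (?S v) = 0"
    if dX: "(X has_derivative X') (at w)" and 0: "\<And>y. y \<in> W \<Longrightarrow> S y (X y) \<bullet> J (N y) = 0" for X X' v
  proof -
    have "((\<lambda>y. S y (X y) \<bullet> J (N y)) has_derivative
        (\<lambda>v. ?S (X w) \<bullet> J (?S v) + (?S (X' v) + T v (X w)) \<bullet> J ?n)) (at w)"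
      using has_derivative_inner[OF has_derivative_apply[OF W(1,2) linS dS dX] J.has_derivative[OF dN[OF W(2)]]]
      by (simp add: sumT)
    from has_derivative_locally_zero[OF this W(1,2) 0, of v] show ?thesis by (simp add: add.commute)
  qed
  \<comment> \<open>The directions are chosen so that third derivatives occur as
    \<open>T ?e (J ?e)\<close> here and as \<open>T (J ?e) ?e\<close> in \<open>eq2\<close>, which
    agree by \<open>symT\<close>.\<close>
  note eq1 = D[OF J.has_derivative[OF dE] zero(1), of ?e]
  note eq2 = D[OF dE zero(2), of "J ?e"]

  define h where "h = ?n \<bullet> ?n"
  define r where "r = w \<bullet> w"
  \<comment> \<open>By \<open>polar\<close>, \<open>- l\<close> is the factor of proportionality of
    \<open>S w\<close> on \<open>K w\<close>.\<close>
  define l where "l = (?S ?n \<bullet> ?n) / h"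
  have h0: "h \<noteq> 0" using nz by (simp add: h_def)
  have pol: "?S u \<bullet> v = - l * (u \<bullet> v)" if "u \<in> K w" "v \<in> K w" for u v
    using polar[OF W(2) that] h0 by (simp add: l_def h_def field_simps)
  have Sw: "?S w = - ?n"
  proof -
    have "((\<lambda>y. N y \<bullet> y) has_derivative (\<lambda>v. ?n \<bullet> v + ?S v \<bullet> w)) (at w)"
      by (intro has_derivative_inner dN W has_derivative_ident)
    from has_derivative_locally_zero[OF this W(1,2) Ny] have "(?S w + ?n) \<bullet> v = 0" for v
      using symS[OF W(2), of w v] by (simp add: inner_add_left inner_add_right inner_commute add.commute)
    from this[of "?S w + ?n"] show ?thesis by (simp add: eq_neg_iff_add_eq_0)
  qed
  \<comment> \<open>Differentiating \<open>N y \<bullet> J y = 0\<close> determines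
    \<open>S w\<close> in the vertical direction; this value produces the final nonzero
    term.\<close>
  have SJw: "?S (J w) = J ?n"
  proof -
    have "((\<lambda>y. N y \<bullet> J y) has_derivative (\<lambda>v. ?n \<bullet> J v + ?S v \<bullet> J w)) (at w)"
      by (intro has_derivative_inner dN W J.has_derivative has_derivative_ident)
    have "?n \<bullet> J v + ?S v \<bullet> J w = 0" for v
      by (rule has_derivative_locally_zero[OF _ W(1,2) NJy]) fact
    then have "(?S (J w) - J ?n) \<bullet> v = 0" for v
      using symS[OF W(2), of "J w" v] inner_J_left[of ?n v] inner_commute[of "?S v" "J w"]
      unfolding inner_diff_left by (smt (verit))
    from this[of "?S (J w) - J ?n"] show ?thesis by simp
  qed
  have orth: "x = 0" if "x \<bullet> w = 0" "x \<bullet> J w = 0" "x \<bullet> ?n = 0" "x \<bullet> J ?n = 0" "x \<bullet> ?e = 0" "x \<bullet> J ?e = 0" for x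
    by (rule unitary_frame_orthogonal_imp_0[OF hermN(2)[OF W(2)] W(3) nz])
      (use that in \<open>simp_all add: herm_eq_0_iff E_def\<close>)
  \<comment> \<open>Symmetry together with \<open>Sw\<close> and \<open>SJw\<close> excludes
    components along \<open>w\<close> and \<open>J w\<close>, and \<open>pol\<close> fixes those
    along \<open>?e\<close>, \<open>J ?e\<close> and \<open>J ?n\<close>. Only the entry along
    \<open>?n\<close> escapes the Carleman condition.\<close>
  have SK: "?S x = (- l) *\<^sub>R x + ((?S x \<bullet> ?n) / h) *\<^sub>R ?n" if x: "x \<in> K w" "x \<bullet> J ?n = 0" for x
  proof -
    have "?S x \<bullet> w = 0" "?S x \<bullet> J w = 0"
      using x symS[OF W(2), of x] Sw SJw by (auto simp: K_def)
    moreover have "?n \<bullet> ?e = 0" "?n \<bullet> J ?e = 0"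
      using Ey[of w] inner_J_left[of ?e ?n] by (simp_all add: inner_commute[of ?n])
    moreover have "x \<bullet> ?n = 0" "x \<bullet> w = 0" "x \<bullet> J w = 0" using x by (simp_all add: K_def)
    moreover have "?n \<bullet> ?n = h" by (simp add: h_def)
    ultimately have "?S x - (- l) *\<^sub>R x - ((?S x \<bullet> ?n) / h) *\<^sub>R ?n = 0"
      using x(2) pol[OF x(1) EK(1)] pol[OF x(1) EK(2)] pol[OF x(1) NJN[OF W(2)]] h0 Ny[OF W(2)] NJy[OF W(2)]
      by (intro orth) (simp_all add: inner_diff_left inner_add_left)
    then show ?thesis by (simp add: algebra_simps)
  qed
  \<comment> \<open>\<open>p\<close> and \<open>q\<close> are the uncontrolled entries. In the
    derivatives of \<open>E\<close> they multiply \<open>J ?e\<close> and \<open>?e\<close>, which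
    \<open>zero\<close> annihilates, and in the products of second derivatives orthogonality removes
    them.\<close>
  obtain p where p: "?S ?e = (- l) *\<^sub>R ?e + p *\<^sub>R ?n"
    using SK[OF EK(1)] Ey by blast
  obtain q where q: "?S (J ?e) = (- l) *\<^sub>R J ?e + q *\<^sub>R ?n"
    using SK[OF EK(2)] Ey by (metis inner_J_J)
  have hc_w_e: "hcross w ?e = - r *\<^sub>R ?n"
    using hermN[OF W(2)]
    by (simp add: E_def hcross_hcross_right herm_self r_def of_real_smult_eq_scaleR)
  have hc_e_n: "hcross ?e ?n = - h *\<^sub>R w"
    using hermN[OF W(2)]
    by (simp add: E_def hcross_hcross herm_self h_def of_real_smult_eq_scaleR)
  have ee: "?e \<bullet> ?e = r * h"
    using hermN[OF W(2)] by (simp add: E_def inner_hcross_self r_def h_def)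
  \<comment> \<open>The component along \<open>J w\<close> is the vertical one. Antilinearity of
    \<open>hcross\<close> gives it the opposite sign in \<open>E'Je\<close>, so the two
    contributions add when \<open>eq2\<close> is subtracted from \<open>eq1\<close>.\<close>
  have E'e: "J (E' ?e) = - h *\<^sub>R J w + (l * r) *\<^sub>R J ?n + p *\<^sub>R J ?e"
    unfolding E'_def p hc_e_n hc.add_right hc.scaleR_right hc_w_e
    by (simp add: J.add J.scaleR E_def[symmetric])
  have E'Je: "E' (J ?e) = h *\<^sub>R J w - (l * r) *\<^sub>R J ?n + q *\<^sub>R ?e"
    unfolding E'_def q hcross_J hc_e_n hc.add_right hc.scaleR_right hc_w_e
    by (simp add: J.add J.scaleR E_def[symmetric])
  have S1: "?S (J ?n) \<bullet> J ?n = - l * h" using pol[OF NJN NJN] W by (simp add: h_def)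
  have z: "?S (J ?e) \<bullet> J ?n = 0" "?S ?e \<bullet> J ?n = 0" using zero[OF W(2)] by auto
  have nn: "J ?n \<bullet> J ?n = h" "?n \<bullet> ?n = h" by (simp_all add: h_def)
  note Slin = linear_add[OF linS[OF W(2)]] linear_diff[OF linS[OF W(2)]] linear_scale[OF linS[OF W(2)]]
  have a1: "?S (J (E' ?e)) \<bullet> J ?n = - h * h - l * r * l * h"
    unfolding E'e Slin SJw inner_add_left inner_scaleR_left z S1 by (simp add: h_def)
  have a2: "?S (E' (J ?e)) \<bullet> J ?n = h * h + l * r * l * h"
    unfolding E'Je Slin SJw inner_add_left inner_diff_left inner_scaleR_left z S1 by (simp add: h_def)
  have ne: "?n \<bullet> J ?e = 0" "J ?e \<bullet> ?n = 0" "?n \<bullet> ?e = 0"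
    using Ey[of w] inner_J_left[of ?e ?n] by (simp_all add: inner_commute[of ?n])
  have b1: "?S (J ?e) \<bullet> J (?S ?e) = l * l * (r * h)"
    unfolding p q J.add J.scaleR
    using Ey[of w] ne by (simp add: inner_diff_left inner_diff_right inner_add_left inner_add_right ee)
  have b2: "?S ?e \<bullet> J (?S (J ?e)) = - l * l * (r * h)"
    unfolding p q J.add J.scaleR
    using Ey[of w] ne by (simp add: inner_diff_left inner_diff_right inner_add_left inner_add_right ee)
  \<comment> \<open>In the difference the multiples of \<open>l * l * (r * h)\<close> from
    \<open>a1\<close>, \<open>a2\<close> and from \<open>b1\<close>, \<open>b2\<close> cancel,
    leaving only the vertical contributions.\<close>
  have "2 * (h * h) = 0"
    using eq1 eq2 symT[of ?e "J ?e"] unfolding inner_add_left a1 a2 b1 b2 by (simp add: algebra_simps)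
  then show False using h0 by simp
qed

section \<open>The Poisson bracket and submersions\<close>

text \<open>Bilinearity and antisymmetry: {a - ib, a + ib} = 2i {a, b}.\<close>

lemma poisson_bracket_cnj:
  fixes P :: "'e::euclidean_space \<times> 'e \<Rightarrow> complex"
  assumes "(a has_derivative a') (at z)" "(b has_derivative b') (at z)"
    and P: "P = (\<lambda>z. complex_of_real (a z) + \<i> * complex_of_real (b z))"
  shows "poisson_bracket (cnj \<circ> P) P z =
    2 * \<i> * complex_of_real (\<Sum>e\<in>Basis. a' (0, e) * b' (e, 0) - a' (e, 0) * b' (0, e))"
proof -
  have "(P has_derivative (\<lambda>h. complex_of_real (a' h) + \<i> * complex_of_real (b' h))) (at z)"
    unfolding P by (intro has_derivative_add has_derivative_mult_right has_derivative_of_real assms)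
  note P1 = frechet_derivative_at[OF this, symmetric]
  have "((\<lambda>z. complex_of_real (a z) - \<i> * complex_of_real (b z)) has_derivative
      (\<lambda>h. complex_of_real (a' h) - \<i> * complex_of_real (b' h))) (at z)"
    by (intro has_derivative_diff has_derivative_mult_right has_derivative_of_real assms)
  moreover have "cnj \<circ> P = (\<lambda>z. complex_of_real (a z) - \<i> * complex_of_real (b z))"
    by (auto simp: P)
  ultimately have "((cnj \<circ> P) has_derivative (\<lambda>h. complex_of_real (a' h) - \<i> * complex_of_real (b' h))) (at z)"
    by simp
  note P2 = frechet_derivative_at[OF this, symmetric]
  show ?thesis
    unfolding poisson_bracket_def P1 P2 of_real_sum sum_distrib_left
    by (intro sum.cong refl) (simp add: algebra_simps)
qed

text \<open>For a constant covector \<open>\<xi>\<close> the bracket of the real part \<open>a\<close> and the imaginary part \<open>b\<close> of the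
  symbol is the derivative of \<open>2 b(\<cdot>, \<xi>)\<close> along the dual of \<open>\<xi>\<close> minus the derivative of \<open>2 a(\<cdot>, \<xi>)\<close>
  along the gradient of \<open>\<psi>\<close>; both can be computed after pulling back along \<open>F\<close>, where the second
  derivatives of \<open>\<xi> \<bullet> F\<close> cancel. The local section \<open>\<sigma>\<close> only serves to show that the symbol is
  differentiable.\<close>

lemma carleman_condition_lift:
  fixes F :: "'n::euclidean_space \<Rightarrow> 'e::euclidean_space" and \<psi> :: "'e \<Rightarrow> real"
    and Q :: "'e \<Rightarrow> 'e \<Rightarrow> 'e \<Rightarrow> real"
  assumes W: "open W" "y \<in> W" and V: "open V" "F ` W \<subseteq> V"
    and \<sigma>: "\<And>x. x \<in> V \<Longrightarrow> \<sigma> x \<in> W" "\<And>x. x \<in> V \<Longrightarrow> F (\<sigma> x) = x" "\<sigma> differentiable (at (F y))"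
    and \<rho>: "\<And>y. y \<in> W \<Longrightarrow> 0 < \<rho> y" "\<And>y. y \<in> W \<Longrightarrow> \<rho> differentiable (at y)"
    and F: "Ck_on 2 W F" and \<psi>: "Ck_on 2 V \<psi>"
    and Q: "\<And>y \<xi> \<eta>. y \<in> W \<Longrightarrow> Q (F y) \<xi> \<eta> = \<rho> y * (grad (\<lambda>y. \<xi> \<bullet> F y) y \<bullet> grad (\<lambda>y. \<eta> \<bullet> F y) y)"
    and P: "\<And>x \<xi>. P (x, \<xi>) = complex_of_real (Q x \<xi> \<xi> - Q x (grad \<psi> x) (grad \<psi> x))
        + 2 * \<i> * complex_of_real (Q x \<xi> (grad \<psi> x))"
    and carleman: "P (F y, \<xi>) = 0 \<Longrightarrow> poisson_bracket (cnj \<circ> P) P (F y, \<xi>) = 0"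
    and M: "M = grad (\<lambda>y. \<xi> \<bullet> F y) y" and N: "N = grad (\<lambda>y. \<psi> (F y)) y"
    and MN: "norm M = norm N" "M \<bullet> N = 0"
  shows "hess (\<lambda>y. \<psi> (F y)) y M \<bullet> M + hess (\<lambda>y. \<psi> (F y)) y N \<bullet> N = 0"
proof -
  \<comment> \<open>\<open>A \<xi> y\<close> is the transpose of the derivative of \<open>F\<close>
    at \<open>y\<close> applied to \<open>\<xi>\<close>, that is, the pulled-back covector.\<close>
  define A where "A \<xi> = grad (\<lambda>y. \<xi> \<bullet> F y)" for \<xi>
  let ?D = "\<lambda>y. frechet_derivative F (at y)"
  let ?\<Psi> = "\<lambda>y. \<psi> (F y)"
  have F1: "Ck_on (Suc (Suc 0)) W F" and \<psi>1: "Ck_on (Suc (Suc 0)) V \<psi>"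
    using F \<psi> by (simp_all add: numeral_2_eq_2)
  have dF: "(F has_derivative ?D y) (at y)" if "y \<in> W" for y
    using Ck_on_SucD(1)[OF F1 that] .
  have d\<psi>: "(\<psi> has_derivative frechet_derivative \<psi> (at x)) (at x)" if "x \<in> V" for x
    using Ck_on_SucD(1)[OF \<psi>1 that] .
  have A: "A \<xi> y \<bullet> v = \<xi> \<bullet> ?D y v" if "y \<in> W" for \<xi> y v
    unfolding A_def by (rule grad_inner[OF has_derivative_inner_right[OF dF[OF that]]])
  have A_expand: "A \<xi> y \<bullet> A \<eta> y = (\<Sum>c\<in>Basis. (\<xi> \<bullet> ?D y c) * (\<eta> \<bullet> ?D y c))" if "y \<in> W" for \<xi> \<eta> y
    by (subst euclidean_inner) (simp add: A[OF that])
  have A_\<psi>: "grad ?\<Psi> y = A (grad \<psi> (F y)) y" if "y \<in> W" for y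
    unfolding A_def by (rule grad_compose[OF dF[OF that] d\<psi>]) (use that V in blast)
  have A_linear: "linear (\<lambda>\<xi>. A \<xi> y)" if "y \<in> W" for y
  proof (rule linearI)
    have *: "u = v" if "\<And>w. u \<bullet> w = v \<bullet> w" for u v :: 'n
      using that by (metis vector_eq_rdot)
    show "A (a + b) y = A a y + A b y" for a b
      by (rule *) (simp add: A[OF that] inner_add_left)
    show "A (r *\<^sub>R a) y = r *\<^sub>R A a y" for r a
      by (rule *) (simp add: A[OF that])
  qed
  define a where "a = (\<lambda>(x, \<xi>). Q x \<xi> \<xi> - Q x (grad \<psi> x) (grad \<psi> x))"
  define b where "b = (\<lambda>(x, \<xi>). 2 * Q x \<xi> (grad \<psi> x))"
  \<comment> \<open>Along \<open>F\<close> the symbol becomes \<open>\<rho>\<close> times the symbol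
    of the flat metric, evaluated at pulled-back covectors.\<close>
  have aF: "a (F y, \<xi>) = \<rho> y * (A \<xi> y \<bullet> A \<xi> y - grad ?\<Psi> y \<bullet> grad ?\<Psi> y)"
    and bF: "b (F y, \<xi>) = 2 * \<rho> y * (A \<xi> y \<bullet> grad ?\<Psi> y)" if "y \<in> W" for y \<xi>
    unfolding a_def b_def using that by (simp_all add: Q A_\<psi> algebra_simps flip: A_def)
  have Py: "P = (\<lambda>z. complex_of_real (a z) + \<i> * complex_of_real (b z))"
    by (auto simp: P a_def b_def fun_eq_iff)
  let ?x = "F y" let ?z = "(F y, \<xi>)"
  have x: "?x \<in> V" using W V by blast
  have K: "(\<lambda>z. ?D (\<sigma> (fst z)) c) differentiable (at ?z)" for c
  proof -
    have "(\<lambda>u. ?D u c) differentiable (at (\<sigma> ?x))"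
      using Ck_on_SucD(1)[OF Ck_on_SucD(2)[OF F1] \<sigma>(1)[OF x], of c] by (auto simp: differentiable_def)
    then have "((\<lambda>u. ?D u c) \<circ> (\<sigma> \<circ> fst)) differentiable (at ?z)"
      by (intro differentiable_chain_at)
        (use \<sigma>(3) in \<open>auto simp: differentiable_def intro: has_derivative_fst[OF has_derivative_ident]\<close>)
    then show ?thesis by (simp add: o_def)
  qed
  have G: "(\<lambda>z. grad \<psi> (fst z)) differentiable (at ?z)"
  proof -
    have "(grad \<psi> \<circ> fst) differentiable (at ?z)"
      by (intro differentiable_chain_at)
        (use has_derivative_grad[OF V(1) \<psi> x] in \<open>auto simp: differentiable_def intro: has_derivative_fst[OF has_derivative_ident]\<close>)
    then show ?thesis by (simp add: o_def)
  qed
  have R: "(\<lambda>z. \<rho> (\<sigma> (fst z))) differentiable (at ?z)"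
  proof -
    have "(\<rho> \<circ> (\<sigma> \<circ> fst)) differentiable (at ?z)"
      by (intro differentiable_chain_at)
        (use \<sigma>(3) \<rho>(2)[OF \<sigma>(1)[OF x]] in \<open>auto simp: differentiable_def intro: has_derivative_fst[OF has_derivative_ident]\<close>)
    then show ?thesis by (simp add: o_def)
  qed
  have S: "snd differentiable (at ?z)"
    by (auto simp: differentiable_def intro: has_derivative_snd[OF has_derivative_ident])
  have QV: "Q x \<xi> \<eta> = \<rho> (\<sigma> x) * (\<Sum>c\<in>Basis. (\<xi> \<bullet> ?D (\<sigma> x) c) * (\<eta> \<bullet> ?D (\<sigma> x) c))" if "x \<in> V" for x \<xi> \<eta>
    using Q[OF \<sigma>(1)[OF that], of \<xi> \<eta>] A_expand[OF \<sigma>(1)[OF that], of \<xi> \<eta>] \<sigma>(2)[OF that] by (simp add: A_def)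
  have open': "open (V \<times> (UNIV :: 'e set))" "?z \<in> V \<times> UNIV"
    using V x by (auto intro: open_Times)
  let ?q = "\<lambda>u v z. \<rho> (\<sigma> (fst z)) * (\<Sum>c\<in>Basis. (u z \<bullet> ?D (\<sigma> (fst z)) c) * (v z \<bullet> ?D (\<sigma> (fst z)) c))"
  have q: "?q u v differentiable (at ?z)" if "u differentiable (at ?z)" "v differentiable (at ?z)" for u v
    by (intro differentiable_mult R differentiable_sum ballI differentiable_inner that K) simp_all
  have "(\<lambda>z. ?q snd snd z - ?q (\<lambda>z. grad \<psi> (fst z)) (\<lambda>z. grad \<psi> (fst z)) z) differentiable (at ?z)"
    by (intro differentiable_diff q S G)
  then obtain a' where "((\<lambda>z. ?q snd snd z - ?q (\<lambda>z. grad \<psi> (fst z)) (\<lambda>z. grad \<psi> (fst z)) z) has_derivative a') (at ?z)"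
    unfolding differentiable_def by blast
  then have a': "(a has_derivative a') (at ?z)"
    by (rule has_derivative_transform_within_open[OF _ open']) (auto simp: a_def QV)
  have "(\<lambda>z. 2 * ?q snd (\<lambda>z. grad \<psi> (fst z)) z) differentiable (at ?z)"
    by (intro differentiable_mult q S G) simp
  then obtain b' where "((\<lambda>z. 2 * ?q snd (\<lambda>z. grad \<psi> (fst z)) z) has_derivative b') (at ?z)"
    unfolding differentiable_def by blast
  then have b': "(b has_derivative b') (at ?z)"
    by (rule has_derivative_transform_within_open[OF _ open']) (auto simp: b_def QV)

  have MA: "M = A \<xi> y" by (simp add: M A_def)
  \<comment> \<open>The two conditions in \<open>MN\<close> say that the real and the imaginary part
    of the symbol vanish.\<close>
  have Pz: "P ?z = 0"
    using MN unfolding Py aF[OF W(2)] bF[OF W(2)] MA[symmetric] N[symmetric] by (simp add: dot_square_norm)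
  have sum0: "(\<Sum>e\<in>Basis. a' (0, e) * b' (e, 0) - a' (e, 0) * b' (0, e)) = 0"
    using carleman[OF Pz] unfolding poisson_bracket_cnj[OF a' b' Py] by (simp del: of_real_sum)

  have dA: "((\<lambda>\<xi>. A \<xi> y) has_derivative (\<lambda>e. A e y)) (at \<xi>)"
    using A_linear[OF W(2)] by (intro bounded_linear.has_derivative[OF _ has_derivative_ident])
      (simp add: linear_conv_bounded_linear)
  have pair: "((\<lambda>\<xi>. (?x, \<xi>)) has_derivative (\<lambda>e. (0, e))) (at \<xi>)"
    by (auto intro!: derivative_eq_intros)
  have a'2: "a' (0, e) = 2 * \<rho> y * (e \<bullet> ?D y M)" for e
  proof -
    have "((\<lambda>\<xi>. \<rho> y * (A \<xi> y \<bullet> A \<xi> y - N \<bullet> N)) has_derivative (\<lambda>e. \<rho> y * (A \<xi> y \<bullet> A e y + A e y \<bullet> A \<xi> y - 0))) (at \<xi>)"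
      by (intro has_derivative_mult_right has_derivative_diff has_derivative_inner dA has_derivative_const)
    then have "((\<lambda>\<xi>. a (?x, \<xi>)) has_derivative (\<lambda>e. \<rho> y * (A \<xi> y \<bullet> A e y + A e y \<bullet> A \<xi> y - 0))) (at \<xi>)"
      unfolding aF[OF W(2)] N .
    from fun_cong[OF has_derivative_unique[OF has_derivative_compose[OF pair a'] this], of e]
    show ?thesis using A[OF W(2), of e M] by (simp add: MA inner_commute)
  qed
  have b'2: "b' (0, e) = 2 * \<rho> y * (e \<bullet> ?D y N)" for e
  proof -
    have "((\<lambda>\<xi>. 2 * \<rho> y * (A \<xi> y \<bullet> N)) has_derivative (\<lambda>e. 2 * \<rho> y * (A e y \<bullet> N))) (at \<xi>)"
      by (intro has_derivative_mult_right has_derivative_inner_left dA)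
    then have "((\<lambda>\<xi>. b (?x, \<xi>)) has_derivative (\<lambda>e. 2 * \<rho> y * (A e y \<bullet> N))) (at \<xi>)"
      unfolding bF[OF W(2)] N .
    from fun_cong[OF has_derivative_unique[OF has_derivative_compose[OF pair b'] this], of e]
    show ?thesis using A[OF W(2), of e N] by simp
  qed
  have "linear (\<lambda>e::'e. (e, 0::'e))" by (rule linearI) auto
  from linear_compose[OF this has_derivative_linear[OF a']] linear_compose[OF this has_derivative_linear[OF b']]
  have lin1: "linear (\<lambda>e. a' (e, 0))" "linear (\<lambda>e. b' (e, 0))"
    by (simp_all add: o_def)
  \<comment> \<open>Each sum collapses to a derivative along the image of \<open>M\<close> or
    \<open>N\<close> under the derivative of \<open>F\<close>, and can therefore be computed
    upstairs by the chain rule.\<close>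
  have "(\<Sum>e\<in>Basis. a' (0, e) * b' (e, 0)) = 2 * \<rho> y * b' (?D y M, 0)"
    "(\<Sum>e\<in>Basis. a' (e, 0) * b' (0, e)) = 2 * \<rho> y * a' (?D y N, 0)"
    using linear_Basis_expansion[OF lin1(2), of "?D y M"] linear_Basis_expansion[OF lin1(1), of "?D y N"]
    by (auto simp: a'2 b'2 sum_distrib_left inner_commute intro!: sum.cong)
  with sum0 have eq: "b' (?D y M, 0) = a' (?D y N, 0)"
    using \<rho>(1)[OF W(2)] by (simp add: sum_subtractf)

  have hA: "(A \<xi> has_derivative hess (\<lambda>y. \<xi> \<bullet> F y) y) (at y)"
    unfolding A_def by (intro has_derivative_grad[OF W(1) _ W(2)] Ck_on_bounded_linear[OF W(1) bounded_linear_inner_right F])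
  have C\<Psi>: "Ck_on 2 W ?\<Psi>" by (rule Ck_on_compose[OF W(1) F \<psi> V(2)])
  have hN: "(grad ?\<Psi> has_derivative hess ?\<Psi> y) (at y)"
    by (rule has_derivative_grad[OF W(1) C\<Psi> W(2)])
  obtain \<rho>' where \<rho>': "(\<rho> has_derivative \<rho>') (at y)" using \<rho>(2)[OF W(2)] by (auto simp: differentiable_def)
  have dFp: "((\<lambda>y. (F y, \<xi>)) has_derivative (\<lambda>v. (?D y v, 0))) (at y)"
    by (intro has_derivative_Pair dF W has_derivative_const)
  let ?h = "hess (\<lambda>y. \<xi> \<bullet> F y) y" let ?k = "hess ?\<Psi> y"
  \<comment> \<open>The derivative of the conformal factor is multiplied by
    \<open>M \<bullet> N\<close> here and by \<open>M \<bullet> M - N \<bullet> N\<close> in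
    \<open>a1\<close>; both are zero by \<open>MN\<close>.\<close>
  have b1: "b' (?D y v, 0) = 2 * \<rho> y * (M \<bullet> ?k v + ?h v \<bullet> N)" for v
  proof -
    have "((\<lambda>y. 2 * \<rho> y * (A \<xi> y \<bullet> grad ?\<Psi> y)) has_derivative
        (\<lambda>v. 2 * \<rho> y * (A \<xi> y \<bullet> ?k v + ?h v \<bullet> grad ?\<Psi> y) + 2 * \<rho>' v * (A \<xi> y \<bullet> grad ?\<Psi> y))) (at y)"
      by (intro has_derivative_mult has_derivative_mult_right has_derivative_inner hA hN \<rho>')
    then have "((\<lambda>y. b (F y, \<xi>)) has_derivative
        (\<lambda>v. 2 * \<rho> y * (A \<xi> y \<bullet> ?k v + ?h v \<bullet> grad ?\<Psi> y) + 2 * \<rho>' v * (A \<xi> y \<bullet> grad ?\<Psi> y))) (at y)"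
      by (rule has_derivative_transform_within_open[OF _ W]) (simp add: bF)
    from fun_cong[OF has_derivative_unique[OF has_derivative_compose[OF dFp b'] this], of v]
    show ?thesis using MN(2) by (simp add: MA[symmetric] N[symmetric])
  qed
  have a1: "a' (?D y v, 0) = 2 * \<rho> y * (?h v \<bullet> M - ?k v \<bullet> N)" for v
  proof -
    have "((\<lambda>y. \<rho> y * (A \<xi> y \<bullet> A \<xi> y - grad ?\<Psi> y \<bullet> grad ?\<Psi> y)) has_derivative
        (\<lambda>v. \<rho> y * ((A \<xi> y \<bullet> ?h v + ?h v \<bullet> A \<xi> y) - (grad ?\<Psi> y \<bullet> ?k v + ?k v \<bullet> grad ?\<Psi> y))
          + \<rho>' v * (A \<xi> y \<bullet> A \<xi> y - grad ?\<Psi> y \<bullet> grad ?\<Psi> y))) (at y)"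
      by (intro has_derivative_mult has_derivative_diff has_derivative_inner hA hN \<rho>')
    then have "((\<lambda>y. a (F y, \<xi>)) has_derivative
        (\<lambda>v. \<rho> y * ((A \<xi> y \<bullet> ?h v + ?h v \<bullet> A \<xi> y) - (grad ?\<Psi> y \<bullet> ?k v + ?k v \<bullet> grad ?\<Psi> y))
          + \<rho>' v * (A \<xi> y \<bullet> A \<xi> y - grad ?\<Psi> y \<bullet> grad ?\<Psi> y))) (at y)"
      by (rule has_derivative_transform_within_open[OF _ W]) (simp add: aF)
    from fun_cong[OF has_derivative_unique[OF has_derivative_compose[OF dFp a'] this], of v]
    show ?thesis using MN(1) by (simp add: MA[symmetric] N[symmetric] dot_square_norm inner_commute algebra_simps)
  qed
  have "?h M \<bullet> N = ?h N \<bullet> M"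
    using hess_symmetric[OF W(1) Ck_on_bounded_linear[OF W(1) bounded_linear_inner_right F] W(2), of \<xi> M N]
    by (simp add: inner_commute)
  then show ?thesis
    using eq \<rho>(1)[OF W(2)] unfolding a1 b1 by (simp add: inner_commute)
qed

section \<open>Affine charts of the projective plane\<close>

definition affine_coords :: "3 \<Rightarrow> 3 \<Rightarrow> 3 \<Rightarrow> complex^3 \<Rightarrow> complex^2" where
  "affine_coords i j k y = vector [y $ j / y $ i, y $ k / y $ i]"

lemma coord_affine_chart: "coord (affine_chart i j k) (hopf (y /\<^sub>R norm y)) = affine_coords i j k y"
  unfolding affine_coords_def by (rule coord_affine_chart_hopf)

lemma open_nth_nonzero: "open {y :: complex^'n. y $ i \<noteq> 0}"
  by (rule open_Collect_neq) (intro continuous_intros)+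

lemma Ck_on_affine_coords: "Ck_on n {y. y $ i \<noteq> 0} (affine_coords i j k)"
proof -
  let ?S = "{y :: complex^3. y $ i \<noteq> 0}"
  define L1 L2 :: "complex \<Rightarrow> complex^2" where "L1 = (\<lambda>a. vector [a, 0])" and "L2 = (\<lambda>a. vector [0, a])"
  have L: "bounded_linear L1" "bounded_linear L2"
    unfolding linear_conv_bounded_linear[symmetric] L1_def L2_def
    by (auto intro!: linearI simp: vec_eq_iff forall_2)
  have "Ck_on n ?S (\<lambda>y. L1 (y $ j * inverse (y $ i)) + L2 (y $ k * inverse (y $ i)))"
    by (intro Ck_on_add Ck_on_bounded_linear[OF _ L(1)] Ck_on_bounded_linear[OF _ L(2)] open_nth_nonzero
        Ck_on_bounded_bilinear[OF _ bounded_bilinear_mult] Ck_on_inverse Ck_on_linear bounded_linear_vec_nth) auto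
  then show ?thesis
    by (rule Ck_on_cong[OF open_nth_nonzero, rotated])
      (simp add: affine_coords_def L1_def L2_def vec_eq_iff forall_2 divide_inverse)
qed

lemma hopf_smult:
  assumes "norm t = 1"
  shows "hopf (t *s z) = hopf z"
proof -
  have "\<exists>s'. s *s z = s' *s (t *s z) \<and> norm s' = 1" if "norm s = 1" for s
    by (rule exI[of _ "s / t"]) (use assms that in \<open>auto simp: vector_smult_assoc norm_divide\<close>)
  moreover have "\<exists>s'. s *s (t *s z) = s' *s z \<and> norm s' = 1" if "norm s = 1" for s
    by (rule exI[of _ "s * t"]) (use assms that in \<open>auto simp: vector_smult_assoc norm_mult\<close>)
  ultimately show ?thesis unfolding hopf_def by blast
qed

lemma norm_smult: "norm (c *s z) = norm c * norm (z :: complex^'n)"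
  using inner_smult[of c z z] by (simp add: norm_eq_sqrt_inner real_sqrt_mult)

text \<open>Equal affine coordinates make the representatives proportional, and since both are unit
  vectors the factor has modulus one.\<close>

lemma affine_chart_injective:
  assumes "d \<in> cp2_atlas" "q \<in> dom_of d" "q' \<in> dom_of d" "coord d q = coord d q'"
  shows "q = q'"
proof -
  obtain i j k where d: "d = affine_chart i j k" and m: "\<And>m. m = i \<or> m = j \<or> m = k"
    using cp2_atlas_cases[OF assms(1)] by blast
  obtain z z' where z: "z \<in> S5" "z $ i \<noteq> 0" "q = hopf z" and z': "z' \<in> S5" "z' $ i \<noteq> 0" "q' = hopf z'"
    using assms(2,3) unfolding d affine_chart_def by auto
  have "z' $ j / z' $ i = z $ j / z $ i" "z' $ k / z' $ i = z $ k / z $ i"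
    using assms(4) coord_affine_chart[of i j k z] coord_affine_chart[of i j k z'] z z'
    unfolding d by (simp_all add: affine_coords_def vec_eq_iff forall_2)
  then have "z' $ n = (z' $ i / z $ i) * z $ n" for n
    using m[of n] z(2) z'(2) by (auto simp: divide_simps mult.commute)
  then have "z' = (z' $ i / z $ i) *s z"
    unfolding vec_eq_iff vector_smult_component by blast
  moreover from this have "norm (z' $ i / z $ i) = 1"
    using z(1) z'(1) by (metis mem_sphere_0 mult.right_neutral norm_smult)
  ultimately show ?thesis unfolding z z' by (metis hopf_smult)
qed

lemma openin_dom_affine_chart: "openin cp2 (dom_of (affine_chart i j k))"
proof -
  have "{z \<in> S5. hopf z \<in> dom_of (affine_chart i j k)} = S5 \<inter> {z. z $ i \<noteq> 0}"
  proof (intro subset_antisym subsetI)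
    fix z assume "z \<in> {z \<in> S5. hopf z \<in> dom_of (affine_chart i j k)}"
    then show "z \<in> S5 \<inter> {z. z $ i \<noteq> 0}" using dom_affine_chart by blast
  next
    fix z assume "z \<in> S5 \<inter> {z. z $ i \<noteq> 0}"
    then show "z \<in> {z \<in> S5. hopf z \<in> dom_of (affine_chart i j k)}"
      unfolding affine_chart_def fst_conv by blast
  qed
  moreover have "dom_of (affine_chart i j k) \<subseteq> hopf ` S5"
    unfolding affine_chart_def fst_conv by blast
  ultimately show ?thesis
    unfolding openin_cp2 by (simp add: openin_open_Int[OF open_nth_nonzero])
qed

lemma affine_chart_cover:
  assumes "z \<in> S5"
  obtains d where "d \<in> cp2_atlas" "hopf z \<in> dom_of d"
proof -
  have "z \<noteq> 0" using assms by auto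
  then obtain i where "z $ i \<noteq> 0" by (auto simp: vec_eq_iff)
  then show thesis
    using exhaust_3[of i] that assms unfolding cp2_atlas_def affine_chart_def by fastforce
qed

text \<open>A section of the affine coordinates: the representative whose \<open>i\<close>-th entry
  is 1. It need not be a unit vector, which the cone allows.\<close>

definition affine_lift :: "3 \<Rightarrow> 3 \<Rightarrow> complex^2 \<Rightarrow> complex^3" where
  "affine_lift i j u = (\<chi> m. if m = i then 1 else if m = j then u $ 1 else u $ 2)"

lemma affine_lift_nth: "affine_lift i j u $ i = 1"
  by (simp add: affine_lift_def)

lemma affine_coords_lift: "i \<noteq> j \<Longrightarrow> i \<noteq> k \<Longrightarrow> j \<noteq> k \<Longrightarrow> affine_coords i j k (affine_lift i j u) = u"
  by (auto simp: affine_coords_def affine_lift_def vec_eq_iff forall_2)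

lemma affine_lift_differentiable: "affine_lift i j differentiable (at u)"
proof -
  have "bounded_linear (\<lambda>u. affine_lift i j u - affine_lift i j 0)"
    unfolding linear_conv_bounded_linear[symmetric]
    by (rule linearI) (auto simp: affine_lift_def vec_eq_iff)
  from bounded_linear_imp_differentiable[OF this, of "at u"]
  have "(\<lambda>u. (affine_lift i j u - affine_lift i j 0) + affine_lift i j 0) differentiable (at u)"
    by (intro differentiable_add differentiable_const)
  then show ?thesis by simp
qed

section \<open>The submersion metric on the cone\<close>

text \<open>The kernel of the differential of the projection at \<open>z\<close> is the complex line
  through \<open>z\<close>, so horizontal means Hermitian-orthogonal to \<open>z\<close>, in every
  chart.\<close>

lemma horizontal_affine_iff:
  assumes "d \<in> cp2_atlas" "hopf z \<in> dom_of d"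
  shows "a \<in> horizontal d z \<longleftrightarrow> a \<bullet> z = 0 \<and> a \<bullet> J z = 0"
proof -
  obtain i j k where d: "d = affine_chart i j k" and m: "\<And>m. m = i \<or> m = j \<or> m = k"
    using cp2_atlas_cases[OF assms(1)] by blast
  have zi: "z $ i \<noteq> 0" using dom_affine_chart assms(2) unfolding d by blast
  have "J z \<in> vertical d z"
    unfolding vertical_def d by (simp add: hopf_diff_affine_chart[OF zi] vec_eq_iff forall_2)
  moreover have "a \<bullet> b = 0" if b: "b \<in> vertical d z" and a: "a \<bullet> z = 0" "a \<bullet> J z = 0" for b
  proof -
    have "b $ j * z $ i = z $ j * b $ i" "b $ k * z $ i = z $ k * b $ i"
      using b zi unfolding vertical_def d
      by (auto simp: hopf_diff_affine_chart vec_eq_iff forall_2)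
    then have "b $ n = (b $ i / z $ i) * z $ n" for n
      using m[of n] zi by (auto simp: nonzero_eq_divide_eq mult.commute)
    then obtain s where s: "b = s *s z"
      unfolding vec_eq_iff vector_smult_component by blast
    have "s *s z = Re s *\<^sub>R z + Im s *\<^sub>R J z"
      by (simp add: vec_eq_iff complex_eq_iff)
    then show ?thesis using a by (simp add: s inner_add_right)
  qed
  ultimately show ?thesis unfolding horizontal_def by blast
qed

text \<open>The projection is constant on rays, so its differential is unchanged when the base point
  and the vector are scaled together.\<close>

lemma hopf_diff_normalize:
  assumes "d \<in> cp2_atlas" "hopf (y /\<^sub>R norm y) \<in> dom_of d" "y \<noteq> 0"
  shows "hopf_diff d y a = hopf_diff d (y /\<^sub>R norm y) (a /\<^sub>R norm y)"
proof -
  obtain i j k where d: "d = affine_chart i j k"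
    using cp2_atlas_cases[OF assms(1)] by blast
  have "y $ i \<noteq> 0" using dom_affine_chart[of "y /\<^sub>R norm y" i j k] assms(2) unfolding d by auto
  from hopf_diff_rotate[OF this, of "of_real (inverse (norm y))"] assms(3)
  show ?thesis unfolding d of_real_smult_eq_scaleR by simp
qed

text \<open>Moving \<open>a\<close> and \<open>b\<close> from \<open>y\<close> to the unit sphere
  divides each by \<open>norm y\<close>; this is the origin of the conformal factor of the
  cone.\<close>

lemma fubini_study_normalize:
  assumes "d \<in> cp2_atlas" "hopf (y /\<^sub>R norm y) \<in> dom_of d" "y \<noteq> 0"
    and a: "a \<bullet> y = 0" "a \<bullet> J y = 0" and b: "b \<bullet> y = 0" "b \<bullet> J y = 0"
  shows "fubini_study d (hopf (y /\<^sub>R norm y)) (hopf_diff d y a) (hopf_diff d y b) = (a \<bullet> b) / (norm y)\<^sup>2"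
proof -
  interpret J: bounded_linear J by (rule bounded_linear_J)
  have "x /\<^sub>R norm y \<in> horizontal d (y /\<^sub>R norm y)" if "x \<bullet> y = 0" "x \<bullet> J y = 0" for x
    using that unfolding horizontal_affine_iff[OF assms(1,2)] by (simp add: J.scaleR)
  from fubini_study_hopf[OF assms(1,2) this[OF a] this[OF b]] show ?thesis
    unfolding hopf_diff_normalize[OF assms(1-3)] by (simp add: power2_eq_square field_simps)
qed

lemma sharp_eqI:
  assumes "bilinear G" "\<And>u. u \<noteq> 0 \<Longrightarrow> 0 < G u u" "\<And>w. G v w = \<xi> \<bullet> w"
  shows "sharp G \<xi> = v"
  unfolding sharp_def
proof (rule the_equality)
  fix v' assume "\<forall>w. G v' w = \<xi> \<bullet> w"
  then have "G (v' - v) (v' - v) = 0"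
    by (simp add: bilinear_lsub[OF assms(1)] assms(3))
  then show "v' = v" using assms(2)[of "v' - v"] by fastforce
qed (use assms(3) in blast)

text \<open>\<open>A\<close> is the transpose of \<open>L\<close>, with horizontal values because
  \<open>L\<close> kills \<open>y\<close> and \<open>J y\<close>. Testing against horizontal
  preimages shows that the vector dual to \<open>\<xi>\<close> is \<open>L (A \<xi>)\<close> times
  the squared norm of \<open>y\<close>, a factor that undoes the division in
  \<open>iso\<close>.\<close>

lemma cometric_submersion:
  fixes G :: "'e::euclidean_space \<Rightarrow> 'e \<Rightarrow> real" and L :: "complex^3 \<Rightarrow> 'e"
  assumes G: "bilinear G" "\<And>u. u \<noteq> 0 \<Longrightarrow> 0 < G u u"
    and L: "linear L" "L y = 0" "L (J y) = 0" "y \<noteq> 0"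
    and onto: "\<And>u. \<exists>a. a \<bullet> y = 0 \<and> a \<bullet> J y = 0 \<and> L a = u"
    and iso: "\<And>a b. \<lbrakk>a \<bullet> y = 0; a \<bullet> J y = 0; b \<bullet> y = 0; b \<bullet> J y = 0\<rbrakk> \<Longrightarrow> G (L a) (L b) = (a \<bullet> b) / (norm y)\<^sup>2"
    and A: "\<And>\<xi> v. A \<xi> \<bullet> v = \<xi> \<bullet> L v"
  shows "cometric G \<xi> \<eta> = (norm y)\<^sup>2 * (A \<xi> \<bullet> A \<eta>)"
    and "a \<bullet> y = 0 \<Longrightarrow> a \<bullet> J y = 0 \<Longrightarrow> \<exists>\<xi>. A \<xi> = a"
proof -
  have Ay: "A \<xi> \<bullet> y = 0" "A \<xi> \<bullet> J y = 0" for \<xi> by (simp_all add: A L)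
  have S: "sharp G \<xi> = (norm y)\<^sup>2 *\<^sub>R L (A \<xi>)" for \<xi>
  proof (rule sharp_eqI[OF G])
    fix w
    obtain b where b: "b \<bullet> y = 0" "b \<bullet> J y = 0" "L b = w" using onto by blast
    show "G ((norm y)\<^sup>2 *\<^sub>R L (A \<xi>)) w = \<xi> \<bullet> w"
      using iso[OF Ay b(1,2), of \<xi>] L(4) b(3) by (simp add: bilinear_lmul[OF G(1)] A)
  qed
  show "cometric G \<xi> \<eta> = (norm y)\<^sup>2 * (A \<xi> \<bullet> A \<eta>)"
    unfolding cometric_def S bilinear_lmul[OF G(1)] bilinear_rmul[OF G(1)] iso[OF Ay Ay] using L(4) by simp
  assume a: "a \<bullet> y = 0" "a \<bullet> J y = 0"
  \<comment> \<open>Up to the factor compensating \<open>iso\<close>, this is the covector dual to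
    \<open>L a\<close>.\<close>
  define \<xi> where "\<xi> = (\<Sum>b\<in>Basis. ((norm y)\<^sup>2 * G (L a) b) *\<^sub>R b)"
  have \<xi>: "\<xi> \<bullet> w = (norm y)\<^sup>2 * G (L a) w" for w
  proof -
    have "linear (G (L a))" using G(1) by (simp add: bilinear_def)
    from linear_Basis_expansion[OF this, of w] show ?thesis
      by (simp add: \<xi>_def inner_sum_left inner_sum_right sum_distrib_left inner_commute mult_ac)
  qed
  have "(A \<xi> - a) \<bullet> v = 0" if "v \<bullet> y = 0" "v \<bullet> J y = 0" for v
    using iso[OF a that] L(4) by (simp add: inner_diff_left A \<xi>)
  moreover have "(A \<xi> - a) \<bullet> y = 0" "(A \<xi> - a) \<bullet> J y = 0"
    using Ay[of \<xi>] a by (simp_all add: inner_diff_left)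
  \<comment> \<open>The difference is horizontal and orthogonal to all horizontal vectors, hence to
    itself.\<close>
  ultimately have "(A \<xi> - a) \<bullet> (A \<xi> - a) = 0" by blast
  then have "A \<xi> = a" by simp
  then show "\<exists>\<xi>. A \<xi> = a" by blast
qed

section \<open>Lifting a locally isometric manifold to the cone\<close>

lemma chart_facts:
  assumes "is_chart X c"
  shows "inj_on (coord c) (dom_of c)" "openin X (dom_of c)"
    "\<And>p. p \<in> dom_of c \<Longrightarrow> param c (coord c p) = p"
    "\<And>U. openin X U \<Longrightarrow> U \<subseteq> dom_of c \<Longrightarrow> open (coord c ` U)"
proof -
  have o: "openin X (dom_of c)" "open (coord c ` dom_of c)"
    and h: "homeomorphic_map (subtopology X (dom_of c)) (top_of_set (coord c ` dom_of c)) (coord c)"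
    using assms by (simp_all add: is_chart_def)
  show "openin X (dom_of c)" by (rule o)
  have "topspace (subtopology X (dom_of c)) = dom_of c"
    using openin_subset[OF o(1)] by auto
  then show inj: "inj_on (coord c) (dom_of c)"
    using homeomorphic_imp_injective_map[OF h] by simp
  show "param c (coord c p) = p" if "p \<in> dom_of c" for p
    unfolding param_def by (rule inv_into_f_f[OF inj that])
  show "open (coord c ` U)" if "openin X U" "U \<subseteq> dom_of c" for U
  proof -
    have "openin (subtopology X (dom_of c)) U"
      using that o by (simp add: openin_open_subtopology)
    then have "openin (top_of_set (coord c ` dom_of c)) (coord c ` U)"
      using homeomorphic_imp_open_map[OF h] by (simp add: open_map_def)
    then show ?thesis using o(2) openin_open_trans by blast
  qed
qed

lemma openin_preimage:
  assumes "continuous_map (subtopology X U) Y f" "openin X U" "openin Y V"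
  shows "openin X {p \<in> U. f p \<in> V}"
proof -
  have "topspace (subtopology X U) = U"
    using openin_subset[OF assms(2)] by auto
  with openin_continuous_map_preimage[OF assms(1,3)]
  have "openin (subtopology X U) {p \<in> U. f p \<in> V}" by (simp only:)
  then show ?thesis using assms(2) by (rule openin_trans_full)
qed

lemma open_cone:
  assumes "openin cp2 O1"
  shows "open {y. y \<noteq> 0 \<and> hopf (y /\<^sub>R norm y) \<in> O1}"
proof -
  obtain G where G: "open G" "{z \<in> S5. hopf z \<in> O1} = S5 \<inter> G"
    using assms unfolding openin_cp2 openin_open by blast
  have "continuous_on (- {0}) (\<lambda>y :: complex^3. y /\<^sub>R norm y)"
    by (intro continuous_intros) auto
  then have "open (- {0} \<inter> (\<lambda>y. y /\<^sub>R norm y) -` G)"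
    by (rule continuous_open_preimage) (auto simp: G)
  moreover have "hopf (y /\<^sub>R norm y) \<in> O1 \<longleftrightarrow> y /\<^sub>R norm y \<in> G" if "y \<noteq> 0" for y
  proof -
    have "y /\<^sub>R norm y \<in> S5" using that by simp
    then show ?thesis using G(2) by blast
  qed
  then have "- {0} \<inter> (\<lambda>y. y /\<^sub>R norm y) -` G = {y. y \<noteq> 0 \<and> hopf (y /\<^sub>R norm y) \<in> O1}"
    by auto
  ultimately show ?thesis by simp
qed

lemma cp2_atlas_distinct:
  assumes "d \<in> cp2_atlas"
  shows "\<exists>i j k. d = affine_chart i j k \<and> i \<noteq> j \<and> i \<noteq> k \<and> j \<noteq> k"
proof (rule cp2_atlas_cases[OF assms])
  fix i j k assume "d = affine_chart i j k" "i \<noteq> j" "i \<noteq> k" "j \<noteq> k"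
  then show ?thesis by blast
qed

text \<open>\<open>F\<close> sends a vector to its complex line, carries the line to the manifold by
  the inverse of a local isometry and reads the result in the chart \<open>c\<close>. The
  conclusions record that \<open>F\<close> is, up to the factor of the cone, a Riemannian submersion
  whose vertical directions are \<open>y\<close> and \<open>J y\<close>.\<close>

lemma local_submersion:
  fixes X :: "'a topology" and A :: "('a, 'e::euclidean_space) chart set"
  assumes X: "riemannian_manifold X A g" and iso: "locally_isometric X A g cp2 cp2_atlas fubini_study"
    and p0: "p0 \<in> topspace X"
  obtains c W F V \<sigma> y0 where
    "c \<in> A" "open W" "y0 \<in> W" "0 \<notin> W" "open V" "V \<subseteq> coord c ` dom_of c" "F ` W \<subseteq> V"
    "\<And>x. x \<in> V \<Longrightarrow> \<sigma> x \<in> W" "\<And>x. x \<in> V \<Longrightarrow> F (\<sigma> x) = x" "\<And>x. x \<in> V \<Longrightarrow> \<sigma> differentiable (at x)"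
    "\<And>k. Ck_on k W F"
    "\<And>y. y \<in> W \<Longrightarrow> frechet_derivative F (at y) y = 0"
    "\<And>y. y \<in> W \<Longrightarrow> frechet_derivative F (at y) (J y) = 0"
    "\<And>y. y \<in> W \<Longrightarrow> surj (frechet_derivative F (at y))"
    "\<And>y \<xi> \<eta>. y \<in> W \<Longrightarrow> cometric (g c (param c (F y))) \<xi> \<eta> =
      (norm y)\<^sup>2 * (grad (\<lambda>y. \<xi> \<bullet> F y) y \<bullet> grad (\<lambda>y. \<eta> \<bullet> F y) y)"
    "\<And>y a. \<lbrakk>y \<in> W; a \<bullet> y = 0; a \<bullet> J y = 0\<rbrakk> \<Longrightarrow> \<exists>\<xi>. grad (\<lambda>y. \<xi> \<bullet> F y) y = a"
proof -
  have man: "smooth_manifold X A" and met: "riemannian_metric A g"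
    using X by (simp_all add: riemannian_manifold_def)
  obtain c where c: "c \<in> A" "p0 \<in> dom_of c"
    using man p0 unfolding smooth_manifold_def by blast
  have "is_chart X c" using man c(1) by (simp add: smooth_manifold_def)
  note cf = chart_facts[OF this]
  obtain U Y f where U: "openin X U" "p0 \<in> U" and Y: "openin cp2 Y"
    and f: "isometry_on X A g U cp2 cp2_atlas fubini_study Y f"
    using iso p0 unfolding locally_isometric_def by blast
  define h where "h = inv_into U f"
  have bij: "bij_betw f U Y" and fs: "smooth_map_on X A U cp2 cp2_atlas f"
    and hs: "smooth_map_on cp2 cp2_atlas Y X A h"
    and fg: "\<And>c d p u v. \<lbrakk>c \<in> A; d \<in> cp2_atlas; p \<in> U; p \<in> dom_of c; f p \<in> dom_of d\<rbrakk> \<Longrightarrow>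
      g c p u v = fubini_study d (f p) (frechet_derivative (coord d \<circ> f \<circ> param c) (at (coord c p)) u)
        (frechet_derivative (coord d \<circ> f \<circ> param c) (at (coord c p)) v)"
    using f unfolding isometry_on_def h_def Let_def by blast+
  have hf: "h (f p) = p" if "p \<in> U" for p
    unfolding h_def using bij that by (simp add: bij_betw_def)
  have fh: "f (h q) = q" "h q \<in> U" if "q \<in> Y" for q
    unfolding h_def using bij that by (simp_all add: bij_betw_def f_inv_into_f inv_into_into)
  have fY: "f p \<in> Y" if "p \<in> U" for p using bij that by (auto simp: bij_betw_def)
  obtain z0 where z0: "z0 \<in> S5" "f p0 = hopf z0"
    using fY[OF U(2)] openin_subset[OF Y] by (auto simp: topspace_cp2)
  obtain d where d: "d \<in> cp2_atlas" "f p0 \<in> dom_of d"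
    using affine_chart_cover[OF z0(1)] z0(2) by metis
  obtain i j k where dij: "d = affine_chart i j k" and ne: "i \<noteq> j" "i \<noteq> k" "j \<noteq> k"
    using cp2_atlas_distinct[OF d(1)] by blast
  \<comment> \<open>\<open>O1\<close> and \<open>O2\<close> correspond to each other under
    \<open>h\<close> and \<open>f\<close> and lie in a single chart on either side, so one pair of
    coordinates serves throughout.\<close>
  define O1 where "O1 = {q \<in> Y \<inter> dom_of d. h q \<in> dom_of c}"
  define O2 where "O2 = {p \<in> U \<inter> dom_of c. f p \<in> dom_of d}"
  define V where "V = coord c ` O2"
  define W where "W = {y. y \<noteq> 0 \<and> hopf (y /\<^sub>R norm y) \<in> O1}"
  define F where "F y = coord c (h (hopf (y /\<^sub>R norm y)))" for y
  define \<sigma> where "\<sigma> x = affine_lift i j ((coord d \<circ> f \<circ> param c) x)" for x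
  have dd: "openin cp2 (dom_of d)" unfolding dij by (rule openin_dom_affine_chart)
  have "openin X ({p \<in> U. f p \<in> dom_of d} \<inter> dom_of c)"
    using openin_preimage[OF conjunct1[OF fs[unfolded smooth_map_on_def]] U(1) dd] cf(2) by (rule openin_Int)
  moreover have "{p \<in> U. f p \<in> dom_of d} \<inter> dom_of c = O2" by (auto simp: O2_def)
  ultimately have V: "open V" unfolding V_def by (intro cf(4)) (auto simp: O2_def)
  have "openin cp2 ({q \<in> Y. h q \<in> dom_of c} \<inter> dom_of d)"
    using openin_preimage[OF conjunct1[OF hs[unfolded smooth_map_on_def]] Y cf(2)] dd by (rule openin_Int)
  moreover have "{q \<in> Y. h q \<in> dom_of c} \<inter> dom_of d = O1" by (auto simp: O1_def)
  ultimately have W: "open W" unfolding W_def by (intro open_cone) simp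
  have hO1: "h q \<in> O2" if "q \<in> O1" for q
    using that fh by (auto simp: O1_def O2_def)
  have fO2: "f p \<in> O1" if "p \<in> O2" for p
    using that hf fY by (auto simp: O1_def O2_def)
  have yi: "y $ i \<noteq> 0" if "y \<in> W" for y
    using that dom_affine_chart[of "y /\<^sub>R norm y" i j k] by (auto simp: W_def O1_def dij)
  have coordd: "coord d (hopf (y /\<^sub>R norm y)) = affine_coords i j k y" for y
    unfolding dij by (rule coord_affine_chart)
  \<comment> \<open>This rewrites \<open>F\<close> on \<open>W\<close> as the coordinate expression
    of \<open>h\<close> after the affine coordinates, both of which are smooth.\<close>
  have paramd: "param d (affine_coords i j k y) = hopf (y /\<^sub>R norm y)" if "y \<in> W" for y
  proof -
    have "inj_on (coord d) (dom_of d)" using affine_chart_injective[OF d(1)] by (rule inj_onI)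
    from inv_into_f_f[OF this, of "hopf (y /\<^sub>R norm y)"] that show ?thesis
      by (simp add: param_def coordd W_def O1_def)
  qed
  have FV: "F ` W \<subseteq> V" using hO1 by (auto simp: F_def V_def W_def)
  have smooth_f: "Ck_on n V (coord d \<circ> f \<circ> param c)" for n
    using fs c(1) d(1) unfolding smooth_map_on_def smooth_on_def V_def O2_def by blast
  have smooth_h: "Ck_on n (coord d ` O1) (coord c \<circ> h \<circ> param d)" for n
    using hs c(1) d(1) unfolding smooth_map_on_def smooth_on_def O1_def by blast
  have smooth_F: "Ck_on n W F" for n
  proof (rule Ck_on_cong[OF W])
    have "Ck_on n W (affine_coords i j k)"
      by (rule Ck_on_subset[OF Ck_on_affine_coords[where i = i]]) (use yi in blast)
    then show "Ck_on n W (\<lambda>y. (coord c \<circ> h \<circ> param d) (affine_coords i j k y))"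
      by (rule Ck_on_compose[OF W _ smooth_h]) (auto simp: W_def simp flip: coordd)
  qed (simp add: paramd F_def)
  have lift: "\<sigma> x \<in> W" "F (\<sigma> x) = x" if "x \<in> V" for x
  proof -
    obtain p where p: "p \<in> O2" "x = coord c p" using \<open>x \<in> V\<close> by (auto simp: V_def)
    have pc: "param c x = p" using p cf(3) by (auto simp: O2_def)
    have si: "\<sigma> x $ i \<noteq> 0" by (simp add: \<sigma>_def affine_lift_nth)
    then have s0: "\<sigma> x \<noteq> 0" by auto
    have "hopf (\<sigma> x /\<^sub>R norm (\<sigma> x)) = f p"
    proof (rule affine_chart_injective[OF d(1)])
      have "\<sigma> x /\<^sub>R norm (\<sigma> x) \<in> {z \<in> S5. z $ i \<noteq> 0}" using si s0 by simp
      then show "hopf (\<sigma> x /\<^sub>R norm (\<sigma> x)) \<in> dom_of d"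
        unfolding dij affine_chart_def fst_conv by blast
      show "f p \<in> dom_of d" using p by (simp add: O2_def)
      show "coord d (hopf (\<sigma> x /\<^sub>R norm (\<sigma> x))) = coord d (f p)"
        unfolding coordd \<sigma>_def affine_coords_lift[OF ne] by (simp add: pc)
    qed
    then show "\<sigma> x \<in> W" "F (\<sigma> x) = x"
      using fO2[OF p(1)] s0 hf p by (auto simp: W_def F_def O2_def)
  qed
  have lift_diff: "\<sigma> differentiable (at x)" if "x \<in> V" for x
  proof -
    have "(affine_lift i j \<circ> (coord d \<circ> f \<circ> param c)) differentiable (at x)"
      by (intro differentiable_chain_at affine_lift_differentiable)
        (use Ck_on_SucD(1)[OF smooth_f that] in \<open>auto simp: differentiable_def\<close>)
    moreover have "affine_lift i j \<circ> (coord d \<circ> f \<circ> param c) = \<sigma>"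
      by (simp add: \<sigma>_def fun_eq_iff)
    ultimately show ?thesis by simp
  qed
  let ?D = "\<lambda>y. frechet_derivative F (at y)"
  have dF: "(F has_derivative ?D y) (at y)" if "y \<in> W" for y
    by (rule Ck_on_SucD(1)[OF smooth_F that])
  \<comment> \<open>The second claim factors the differential of the projection through that of
    \<open>F\<close>, because applying \<open>f\<close> after \<open>F\<close> gives the projection
    back. Facts about \<open>hopf_diff\<close> thereby become facts about \<open>F\<close>.\<close>
  have pt: "g c (param c (F y)) u v =
      fubini_study d (hopf (y /\<^sub>R norm y)) (frechet_derivative (coord d \<circ> f \<circ> param c) (at (F y)) u)
        (frechet_derivative (coord d \<circ> f \<circ> param c) (at (F y)) v)"
    "hopf_diff d y a = frechet_derivative (coord d \<circ> f \<circ> param c) (at (F y)) (?D y a)"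
    "bilinear (g c (param c (F y)))" "w \<noteq> 0 \<Longrightarrow> 0 < g c (param c (F y)) w w"
    "linear (frechet_derivative (coord d \<circ> f \<circ> param c) (at (F y)))"
    if y: "y \<in> W" for y u v w a
  proof -
    have q: "hopf (y /\<^sub>R norm y) \<in> O1" using y by (simp add: W_def)
    then have p: "h (hopf (y /\<^sub>R norm y)) \<in> O2" by (rule hO1)
    then have pF: "param c (F y) = h (hopf (y /\<^sub>R norm y))"
      unfolding F_def by (intro cf(3)) (simp add: O2_def)
    have fp: "f (param c (F y)) = hopf (y /\<^sub>R norm y)"
      unfolding pF using q by (simp add: fh O1_def)
    have m: "param c (F y) \<in> U" "param c (F y) \<in> dom_of c" "f (param c (F y)) \<in> dom_of d" "coord c (param c (F y)) = F y"
      using p unfolding pF by (simp_all add: O2_def F_def)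
    show "g c (param c (F y)) u v =
      fubini_study d (hopf (y /\<^sub>R norm y)) (frechet_derivative (coord d \<circ> f \<circ> param c) (at (F y)) u)
        (frechet_derivative (coord d \<circ> f \<circ> param c) (at (F y)) v)"
      using fg[OF c(1) d(1) m(1-3)] unfolding m(4) fp .
    show "bilinear (g c (param c (F y)))" "w \<noteq> 0 \<Longrightarrow> 0 < g c (param c (F y)) w w"
      using met c(1) m(2) unfolding riemannian_metric_def by blast+
    have dT: "((coord d \<circ> f \<circ> param c) has_derivative frechet_derivative (coord d \<circ> f \<circ> param c) (at (F y))) (at (F y))"
      by (rule Ck_on_SucD(1)[OF smooth_f]) (use FV y in blast)
    then show "linear (frechet_derivative (coord d \<circ> f \<circ> param c) (at (F y)))"
      by (rule has_derivative_linear)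
    have "((\<lambda>y. coord d (hopf (y /\<^sub>R norm y))) has_derivative
        (\<lambda>a. frechet_derivative (coord d \<circ> f \<circ> param c) (at (F y)) (?D y a))) (at y)"
    proof (rule has_derivative_transform_within_open[OF has_derivative_compose[OF dF[OF y] dT] W y])
      fix y assume y: "y \<in> W"
      then have q: "hopf (y /\<^sub>R norm y) \<in> O1" by (simp add: W_def)
      have "param c (F y) = h (hopf (y /\<^sub>R norm y))"
        unfolding F_def using hO1[OF q] by (intro cf(3)) (simp add: O2_def)
      then show "(coord d \<circ> f \<circ> param c) (F y) = coord d (hopf (y /\<^sub>R norm y))"
        using q by (simp add: fh O1_def)
    qed
    from frechet_derivative_at[OF this]
    show "hopf_diff d y a = frechet_derivative (coord d \<circ> f \<circ> param c) (at (F y)) (?D y a)"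
      unfolding hopf_diff_def by metis
  qed
  \<comment> \<open>A vector killed by the derivative of \<open>f\<close> has length zero by the
    isometry property, contradicting positivity of \<open>g\<close>.\<close>
  have inj: "u = v" if y: "y \<in> W" and eq: "frechet_derivative (coord d \<circ> f \<circ> param c) (at (F y)) u =
      frechet_derivative (coord d \<circ> f \<circ> param c) (at (F y)) v" for y u v
  proof (rule ccontr)
    assume "u \<noteq> v"
    then have "0 < g c (param c (F y)) (u - v) (u - v)" using pt(4)[OF y] by simp
    moreover have "frechet_derivative (coord d \<circ> f \<circ> param c) (at (F y)) (u - v) = 0"
      using eq by (simp add: linear_diff[OF pt(5)[OF y]])
    \<comment> \<open>\<open>fubini_study\<close> is a definite description, so even its value at
      zero vectors has to be found from horizontal lifts, here the zero vector.\<close>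
    moreover have "fubini_study d (hopf (y /\<^sub>R norm y)) 0 0 = 0"
    proof -
      have "hopf_diff d y 0 = 0" unfolding dij by (simp add: hopf_diff_affine_chart[OF yi[OF y]] vec_eq_iff forall_2)
      then show ?thesis
        using fubini_study_normalize[OF d(1), of y 0 0] y by (simp add: W_def O1_def)
    qed
    ultimately show False by (simp add: pt(1)[OF y])
  qed
  have ker: "?D y y = 0" "?D y (J y) = 0" if y: "y \<in> W" for y
  proof -
    have "hopf_diff d y y = 0" "hopf_diff d y (J y) = 0"
      unfolding dij by (simp_all add: hopf_diff_affine_chart[OF yi[OF y]] vec_eq_iff forall_2)
    then show "?D y y = 0" "?D y (J y) = 0"
      unfolding pt(2)[OF y] by (auto intro!: inj[OF y] simp: linear_0[OF pt(5)[OF y]])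
  qed
  have onto: "\<exists>a. a \<bullet> y = 0 \<and> a \<bullet> J y = 0 \<and> ?D y a = u" if y: "y \<in> W" for y u
  proof -
    interpret J: bounded_linear J by (rule bounded_linear_J)
    let ?w = "y /\<^sub>R norm y"
    have y0: "y \<noteq> 0" and w: "hopf ?w \<in> dom_of d" using y by (auto simp: W_def O1_def)
    then have "?w \<in> S5" by simp
    then have "frechet_derivative (coord d \<circ> f \<circ> param c) (at (F y)) u \<in> hopf_diff d ?w ` horizontal d ?w"
      by (simp only: hopf_diff_horizontal_onto[OF d(1) _ w] UNIV_I)
    then obtain b where b: "b \<in> horizontal d ?w"
      "hopf_diff d ?w b = frechet_derivative (coord d \<circ> f \<circ> param c) (at (F y)) u"
      by (elim imageE) simp
    have "b \<bullet> y = 0" "b \<bullet> J y = 0"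
      using b(1) y0 unfolding horizontal_affine_iff[OF d(1) w] by (simp_all add: J.scaleR)
    \<comment> \<open>The factor \<open>norm y\<close> turns a horizontal lift at the normalized
      point into one at \<open>y\<close>.\<close>
    moreover have "?D y (norm y *\<^sub>R b) = u"
      using b(2) y0 pt(2)[OF y, of "norm y *\<^sub>R b"] unfolding hopf_diff_normalize[OF d(1) w y0]
      by (intro inj[OF y]) simp
    ultimately show ?thesis by (intro exI[of _ "norm y *\<^sub>R b"]) simp
  qed
  have isoF: "g c (param c (F y)) (?D y a) (?D y b) = (a \<bullet> b) / (norm y)\<^sup>2"
    if y: "y \<in> W" and "a \<bullet> y = 0" "a \<bullet> J y = 0" "b \<bullet> y = 0" "b \<bullet> J y = 0" for y a b
    unfolding pt(1)[OF y] pt(2)[OF y, symmetric]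
    by (rule fubini_study_normalize[OF d(1)]) (use that in \<open>auto simp: W_def O1_def\<close>)
  note G = cometric_submersion[OF pt(3,4) has_derivative_linear[OF dF] ker _ onto isoF
      grad_inner[OF has_derivative_inner_right[OF dF]]]
  have p0V: "coord c p0 \<in> V" using U(2) c(2) d(2) by (simp add: V_def O2_def)
  have surjF: "surj (?D y)" if "y \<in> W" for y
    using onto[OF that] by (metis surjI)
  have W0: "y \<noteq> 0" if "y \<in> W" for y using that by (simp add: W_def)
  show thesis
  proof (rule that[OF c(1) W lift(1)[OF p0V] _ V _ FV lift lift_diff smooth_F ker surjF])
    show "0 \<notin> W" "V \<subseteq> coord c ` dom_of c" by (auto simp: W_def V_def O2_def)
    show "cometric (g c (param c (F y))) \<xi> \<eta> =
      (norm y)\<^sup>2 * (grad (\<lambda>y. \<xi> \<bullet> F y) y \<bullet> grad (\<lambda>y. \<eta> \<bullet> F y) y)" if "y \<in> W" for y \<xi> \<eta>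
      by (rule G(1)) (use that W0 in auto)
    show "\<exists>\<xi>. grad (\<lambda>y. \<xi> \<bullet> F y) y = a" if "y \<in> W" "a \<bullet> y = 0" "a \<bullet> J y = 0" for y a
      by (rule G(2)) (use that W0 in auto)
  qed
qed

section \<open>Contradiction from a weight\<close>

theorem mainTheorem7:
  fixes X :: "'a topology"
    and A :: "('a, 'e::euclidean_space) chart set"
    and g :: "('a, 'e) metric_components"
  assumes "riemannian_manifold X A g"
    and "topspace X \<noteq> {}"
    and "locally_isometric X A g cp2 cp2_atlas fubini_study"
  shows "\<not> (\<exists>\<phi>. limiting_carleman_weight A g \<phi>)"
proof
  assume "\<exists>\<phi>. limiting_carleman_weight A g \<phi>"
  then obtain \<phi> where \<phi>: "limiting_carleman_weight A g \<phi>" by blast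
  obtain p0 where p0: "p0 \<in> topspace X" using assms(2) by blast
  show False
  proof (rule local_submersion[OF assms(1,3) p0])
    fix c :: "('a, 'e) chart" and W :: "(complex^3) set" and F :: "complex^3 \<Rightarrow> 'e"
      and V :: "'e set" and \<sigma> :: "'e \<Rightarrow> complex^3" and y0 :: "complex^3"
    assume
      c: "c \<in> A" and W: "open W" "y0 \<in> W" "0 \<notin> W"
      and V: "open V" "V \<subseteq> coord c ` dom_of c" "F ` W \<subseteq> V"
      and \<sigma>: "\<And>x. x \<in> V \<Longrightarrow> \<sigma> x \<in> W" "\<And>x. x \<in> V \<Longrightarrow> F (\<sigma> x) = x" "\<And>x. x \<in> V \<Longrightarrow> \<sigma> differentiable (at x)"
      and F: "\<And>k. Ck_on k W F"
      and ker: "\<And>y. y \<in> W \<Longrightarrow> frechet_derivative F (at y) y = 0"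
        "\<And>y. y \<in> W \<Longrightarrow> frechet_derivative F (at y) (J y) = 0"
      and surjF: "\<And>y. y \<in> W \<Longrightarrow> surj (frechet_derivative F (at y))"
      and com: "\<And>y \<xi> \<eta>. y \<in> W \<Longrightarrow> cometric (g c (param c (F y))) \<xi> \<eta> =
        (norm y)\<^sup>2 * (grad (\<lambda>y. \<xi> \<bullet> F y) y \<bullet> grad (\<lambda>y. \<eta> \<bullet> F y) y)"
      and cov: "\<And>y a. \<lbrakk>y \<in> W; a \<bullet> y = 0; a \<bullet> J y = 0\<rbrakk> \<Longrightarrow> \<exists>\<xi>. grad (\<lambda>y. \<xi> \<bullet> F y) y = a"
    define \<psi> where "\<psi> = \<phi> \<circ> param c"
    let ?\<Psi> = "\<lambda>y. \<psi> (F y)"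
    have \<psi>: "Ck_on n V \<psi>" for n
      using \<phi> c V(2) unfolding limiting_carleman_weight_def smooth_function_def smooth_on_def \<psi>_def
      by (blast intro: Ck_on_subset)
    have \<Psi>: "Ck_on n W ?\<Psi>" for n
      by (rule Ck_on_compose[OF W(1) F \<psi> V(3)])
    have diff_grad: "differential c \<phi> = grad \<psi>"
      by (simp add: fun_eq_iff differential_def grad_def \<psi>_def)
    have dF: "(F has_derivative frechet_derivative F (at y)) (at y)" if "y \<in> W" for y
      by (rule Ck_on_SucD(1)[OF F that])
    have grad\<Psi>: "grad ?\<Psi> y \<bullet> v = grad \<psi> (F y) \<bullet> frechet_derivative F (at y) v" if y: "y \<in> W" for y v
    proof -
      have "(\<psi> has_derivative frechet_derivative \<psi> (at (F y))) (at (F y))"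
        by (rule Ck_on_SucD(1)[OF \<psi>]) (use V y in blast)
      from grad_compose[OF dF[OF y] this] show ?thesis
        using grad_inner[OF has_derivative_inner_right[OF dF[OF y]]] by simp
    qed
    \<comment> \<open>Two derivatives of the gradient, so three of the lifted weight, are what the
      symmetry of \<open>T\<close> requires.\<close>
    have hess\<Psi>: "Ck_on 2 W (grad ?\<Psi>)"
      by (rule Ck_on_grad[OF W(1) \<Psi>])
    have hess1: "Ck_on (Suc (Suc 0)) W (grad ?\<Psi>)"
      using hess\<Psi> by (simp add: numeral_2_eq_2)
    have "grad ?\<Psi> y0 = 0"
    proof (rule flat_rigidity[OF W(1,2), where S = "hess ?\<Psi>"
          and T = "\<lambda>v. frechet_derivative (\<lambda>y. hess ?\<Psi> y v) (at y0)"])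
      show "y0 \<noteq> 0" using W by blast
      show "(grad ?\<Psi> has_derivative hess ?\<Psi> y) (at y)" if "y \<in> W" for y
        by (rule has_derivative_grad[OF W(1) \<Psi> that])
      show "((\<lambda>y. hess ?\<Psi> y v) has_derivative frechet_derivative (\<lambda>y. hess ?\<Psi> y v) (at y0)) (at y0)" for v
        by (rule Ck_on_SucD(1)[OF Ck_on_SucD(2)[OF hess1] W(2)])
      show "frechet_derivative (\<lambda>y. hess ?\<Psi> y u) (at y0) v = frechet_derivative (\<lambda>y. hess ?\<Psi> y v) (at y0) u" for u v
        by (rule symmetric_second_derivative_vector[OF hess\<Psi> W(1,2)])
      show "hess ?\<Psi> y u \<bullet> v = u \<bullet> hess ?\<Psi> y v" if "y \<in> W" for y u v
        by (rule hess_symmetric[OF W(1) \<Psi> that])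
      show "grad ?\<Psi> y \<bullet> y = 0" "grad ?\<Psi> y \<bullet> J y = 0" if "y \<in> W" for y
        using that by (simp_all add: grad\<Psi> ker)
      fix y x assume y: "y \<in> W" and x: "x \<bullet> y = 0" "x \<bullet> J y = 0" "x \<bullet> grad ?\<Psi> y = 0" "norm x = norm (grad ?\<Psi> y)"
      \<comment> \<open>Every horizontal vector is a pulled-back covector; the remaining conditions
        on \<open>x\<close> then place \<open>\<xi>\<close> in the zero set of the symbol over
        \<open>F y\<close>.\<close>
      obtain \<xi> where \<xi>: "grad (\<lambda>y. \<xi> \<bullet> F y) y = x" using cov[OF y x(1,2)] by blast
      let ?P = "carleman_symbol g \<phi> c"
      obtain p where p: "p \<in> dom_of c" "F y = coord c p" using V y by blast
      show "hess ?\<Psi> y x \<bullet> x + hess ?\<Psi> y (grad ?\<Psi> y) \<bullet> grad ?\<Psi> y = 0"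
      proof (rule carleman_condition_lift[OF W(1) y V(1,3) \<sigma>(1,2) \<sigma>(3), where P = ?P and \<xi> = \<xi>
            and Q = "\<lambda>x. cometric (g c (param c x))" and \<rho> = "\<lambda>y. (norm y)\<^sup>2"])
        show "F y \<in> V" using V y by blast
        show "0 < (norm y)\<^sup>2" if "y \<in> W" for y using that W by (metis zero_less_norm_iff zero_less_power)
        show "(\<lambda>y. (norm y)\<^sup>2) differentiable at y" for y :: "complex^3"
          by (rule differentiable_sqnorm_at)
        show "?P (x, \<xi>) = complex_of_real (cometric (g c (param c x)) \<xi> \<xi> - cometric (g c (param c x)) (grad \<psi> x) (grad \<psi> x))
          + 2 * \<i> * complex_of_real (cometric (g c (param c x)) \<xi> (grad \<psi> x))" for x \<xi>
          by (simp add: carleman_symbol_def Let_def diff_grad)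
        show "poisson_bracket (cnj \<circ> ?P) ?P (F y, \<xi>) = 0" if "?P (F y, \<xi>) = 0"
          using \<phi> c p that unfolding limiting_carleman_weight_def Let_def by metis
      qed (use F \<psi> com \<xi> x in auto)
    qed
    \<comment> \<open>Since \<open>F\<close> is a submersion, a critical point of the lift lies over
      a critical point of the weight, which a limiting Carleman weight does not have.\<close>
    then have "grad \<psi> (F y0) \<bullet> frechet_derivative F (at y0) v = 0" for v
      using grad\<Psi>[OF W(2), of v] by simp
    then have "grad \<psi> (F y0) \<bullet> u = 0" for u
      using surjF[OF W(2)] by (metis surjD)
    then have "grad \<psi> (F y0) = 0" by (metis inner_eq_zero_iff)
    moreover obtain p where "p \<in> dom_of c" "F y0 = coord c p" using V W by blast
    ultimately show False
      using \<phi> c unfolding limiting_carleman_weight_def diff_grad[symmetric] by metis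
  qed
qed

end
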